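(* The symmetric inverse monoid $\mathfrak I_n$ is a projective bias, for every positive integer $n$.
   Context: A semigroup $S$ is inverse if every $x\in S$ has a unique $x^{-1}$ with $x=xx^{-1}x$ and $x^{-1}=x^{-1}xx^{-1}$. The natural ordering is $x\le y$ iff $x=yx^{-1}x$. In an inverse semigroup with zero, $x,y$ are orthogonal if $x^{-1}y=xy^{-1}=0$. A Boolean inverse semigroup is an inverse semigroup $S$ with zero whose idempotents form a generalized Boolean algebra and in which any two orthogonal $x,y$ have a join $x\oplus y$ for the natural ordering. A bias is the same as a Boolean inverse semigroup (viewed as an algebra in a suitable variety), and bias homomorphisms are exactly the additive semigroup homomorphisms, i.e. the semigroup homomorphisms $f$ with $f(0)=0$ and $f(x\oplus y)=f(x)\oplus f(y)$ for orthogonal $x,y$ (no preservation of units is required). $\mathfrak I_n$ is the Boolean inverse monoid of all partial one-to-one functions on $\{1,\dots,n\}$ under composition. A bias $P$ is projective if every surjective bias homomorphism $\varphi\colon S\twoheadrightarrow P$, with $S$ any bias, has a right inverse, i.e. there is a bias homomorphism $\psi\colon P\to S$ with $\varphi\circ\psi=\mathrm{id}_P$. *)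

theory Defs
  imports "HOL-Algebra.Lattice"
begin

record 'a semigroup_zero = "'a partial_object" +
  smult :: "['a, 'a] \<Rightarrow> 'a" (infixl \<open>\<cdot>\<index>\<close> 70)
  szero :: 'a

definition is_inverse :: "('a, 'm) semigroup_zero_scheme \<Rightarrow> 'a \<Rightarrow> 'a \<Rightarrow> bool" where
  "is_inverse S x y \<longleftrightarrow> x = x \<cdot>\<^bsub>S\<^esub> y \<cdot>\<^bsub>S\<^esub> x \<and> y = y \<cdot>\<^bsub>S\<^esub> x \<cdot>\<^bsub>S\<^esub> y"

locale inverse_semigroup_zero =
  fixes S (structure)
  assumes mult_closed: "x \<in> carrier S \<Longrightarrow> y \<in> carrier S \<Longrightarrow> x \<cdot> y \<in> carrier S"
    and mult_assoc: "x \<in> carrier S \<Longrightarrow> y \<in> carrier S \<Longrightarrow> z \<in> carrier S \<Longrightarrow>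
      (x \<cdot> y) \<cdot> z = x \<cdot> (y \<cdot> z)"
    and ex1_inverse: "x \<in> carrier S \<Longrightarrow> \<exists>!y. y \<in> carrier S \<and> is_inverse S x y"
    and zero_closed: "szero S \<in> carrier S"
    and zero_mult: "x \<in> carrier S \<Longrightarrow> szero S \<cdot> x = szero S"
    and mult_zero: "x \<in> carrier S \<Longrightarrow> x \<cdot> szero S = szero S"

definition sinv :: "('a, 'm) semigroup_zero_scheme \<Rightarrow> 'a \<Rightarrow> 'a" where
  "sinv S x = (THE y. y \<in> carrier S \<and> is_inverse S x y)"

definition natural_order :: "('a, 'm) semigroup_zero_scheme \<Rightarrow> 'a gorder" where
  "natural_order S =
    \<lparr>carrier = carrier S, eq = (=), le = (\<lambda>x y. x = y \<cdot>\<^bsub>S\<^esub> sinv S x \<cdot>\<^bsub>S\<^esub> x)\<rparr>"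

definition idempotents :: "('a, 'm) semigroup_zero_scheme \<Rightarrow> 'a set" where
  "idempotents S = {e \<in> carrier S. e \<cdot>\<^bsub>S\<^esub> e = e}"

definition orthogonal :: "('a, 'm) semigroup_zero_scheme \<Rightarrow> 'a \<Rightarrow> 'a \<Rightarrow> bool" where
  "orthogonal S x y \<longleftrightarrow> sinv S x \<cdot>\<^bsub>S\<^esub> y = szero S \<and> x \<cdot>\<^bsub>S\<^esub> sinv S y = szero S"

text \<open>A generalized Boolean algebra is a distributive lattice with a least element in which every
  interval from the least element is complemented; a greatest element is not required.\<close>

locale generalized_boolean_algebra = lattice L + weak_partial_order_bottom L for L (structure) +
  assumes meet_join_distrib:
      "x \<in> carrier L \<Longrightarrow> y \<in> carrier L \<Longrightarrow> z \<in> carrier L \<Longrightarrow>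
        x \<sqinter> (y \<squnion> z) = (x \<sqinter> y) \<squnion> (x \<sqinter> z)"
    and relative_complement:
      "x \<in> carrier L \<Longrightarrow> y \<in> carrier L \<Longrightarrow> x \<sqsubseteq> y \<Longrightarrow>
        \<exists>z \<in> carrier L. x \<sqinter> z = \<bottom> \<and> x \<squnion> z = y"

locale bias = inverse_semigroup_zero S for S (structure) +
  assumes idempotents_gba:
      "generalized_boolean_algebra ((natural_order S)\<lparr>carrier := idempotents S\<rparr>)"
    and orthogonal_join:
      "x \<in> carrier S \<Longrightarrow> y \<in> carrier S \<Longrightarrow> orthogonal S x y \<Longrightarrow>
        \<exists>s. least (natural_order S) s (Upper (natural_order S) {x, y})"

text \<open>Additive semigroup homomorphisms. The homomorphic image of an orthogonal pair is orthogonal,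
  so both joins below exist.\<close>

definition bias_hom ::
    "('a, 'm) semigroup_zero_scheme \<Rightarrow> ('b, 'n) semigroup_zero_scheme \<Rightarrow> ('a \<Rightarrow> 'b) set" where
  "bias_hom S T = {f \<in> carrier S \<rightarrow> carrier T.
     (\<forall>x \<in> carrier S. \<forall>y \<in> carrier S. f (x \<cdot>\<^bsub>S\<^esub> y) = f x \<cdot>\<^bsub>T\<^esub> f y) \<and>
     f (szero S) = szero T \<and>
     (\<forall>x \<in> carrier S. \<forall>y \<in> carrier S. orthogonal S x y \<longrightarrow>
        f (x \<squnion>\<^bsub>natural_order S\<^esub> y) = f x \<squnion>\<^bsub>natural_order T\<^esub> f y)}"

text \<open>HOL cannot quantify over types inside a formula, so the element type of the biases mapping
  onto \<open>P\<close> is a parameter; a theorem in which \<open>'s\<close> is a free type variable covers all of them.\<close>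

definition projective_bias ::
    "'s itself \<Rightarrow> ('p, 'm) semigroup_zero_scheme \<Rightarrow> bool" where
  "projective_bias _ P \<longleftrightarrow> bias P \<and>
     (\<forall>(S :: 's semigroup_zero) \<phi>.
        bias S \<and> \<phi> \<in> bias_hom S P \<and> \<phi> ` carrier S = carrier P \<longrightarrow>
        (\<exists>\<psi> \<in> bias_hom P S. \<forall>x \<in> carrier P. \<phi> (\<psi> x) = x))"

definition symmetric_inverse_monoid :: "nat \<Rightarrow> (nat \<rightharpoonup> nat) semigroup_zero" where
  "symmetric_inverse_monoid n =
    \<lparr>carrier = {f. dom f \<subseteq> {1..n} \<and> ran f \<subseteq> {1..n} \<and> inj_on f (dom f)},
     smult = (\<circ>\<^sub>m), szero = Map.empty\<rparr>"

end

theory Submission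
  imports Defs
begin

text \<open>Write \<open>e\<^sub>i\<^sub>j\<close> for the partial function on \<open>{1..n}\<close> whose only value is \<open>j \<mapsto> i\<close>. These
  matrix units multiply by \<open>e\<^sub>i\<^sub>j e\<^sub>k\<^sub>l = e\<^sub>i\<^sub>l\<close> if \<open>j = k\<close> and \<open>0\<close> otherwise, and every partial
  bijection \<open>f\<close> is the orthogonal join of the \<open>e\<^bsub>f(j) j\<^esub>\<close>. The symmetric inverse monoid
  is therefore the bias freely generated by a system of matrix units, and projectivity amounts to two
  facts.

  \<^item> A system \<open>u\<^sub>i\<^sub>j\<close> of matrix units in any bias \<open>S\<close> extends to an additive homomorphism \<open>\<psi>\<close> into
    \<open>S\<close> (lemma \<open>matrix_elem_bias_hom\<close>). Instead of calculating with finite joins, \<open>\<psi> f\<close> is pinned down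
    by its columns: it is the only \<open>s\<close> supported on the join \<open>E\<close> of the \<open>u\<^sub>j\<^sub>j\<close> with
    \<open>s u\<^sub>j\<^sub>j = u\<^bsub>f(j) j\<^esub>\<close>, or \<open>s u\<^sub>j\<^sub>j = 0\<close> where \<open>f\<close> is undefined. Two elements supported on \<open>E\<close> with
    the same columns are equal, so that multiplicativity and additivity of \<open>\<psi>\<close> are checked column by
    column.

  \<^item> Matrix units lift along a surjective homomorphism \<open>\<phi>\<close> (lemma \<open>lift_matrix_units\<close>). Choose
    preimages of the elements \<open>e\<^sub>i\<^sub>a\<close> of one column \<open>a\<close>. Their range idempotents are orthogonal only after
    applying \<open>\<phi>\<close>; relative complements in \<open>S\<close> make them orthogonal without changing the images, because
    \<open>\<phi>\<close> is additive. Multiplying on the right by an idempotent over \<open>e\<^sub>a\<^sub>a\<close> below all the domain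
    idempotents gives elements \<open>b\<^sub>i\<close> with a common domain and orthogonal ranges, and \<open>u\<^sub>i\<^sub>j = b\<^sub>i b\<^sub>j\<^sup>-\<^sup>1\<close> are matrix
    units over the \<open>e\<^sub>i\<^sub>j\<close>.

  If \<open>u\<^sub>i\<^sub>j\<close> lifts \<open>e\<^sub>i\<^sub>j\<close>, then \<open>\<phi> (\<psi> f)\<close> and \<open>f\<close> are partial bijections with the same columns,
  that is, with the same values, so \<open>\<psi>\<close> is a right inverse of \<open>\<phi>\<close>.\<close>

section \<open>Inverse semigroups and their natural order\<close>

context inverse_semigroup_zero
begin

abbreviation inverse_elem :: "'a \<Rightarrow> 'a" ("_\<^sup>-" [1000] 999)
  where "x\<^sup>- \<equiv> sinv S x"

abbreviation idem :: "'a \<Rightarrow> bool"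
  where "idem e \<equiv> e \<in> idempotents S"

definition nle :: "'a \<Rightarrow> 'a \<Rightarrow> bool" (infix "\<preceq>" 50)
  where "x \<preceq> y \<longleftrightarrow> x = y \<cdot> x\<^sup>- \<cdot> x"

definition is_join :: "'a \<Rightarrow> 'a \<Rightarrow> 'a \<Rightarrow> bool"
  where "is_join x y s \<longleftrightarrow> s \<in> carrier S \<and> x \<preceq> s \<and> y \<preceq> s \<and>
    (\<forall>t \<in> carrier S. x \<preceq> t \<longrightarrow> y \<preceq> t \<longrightarrow> s \<preceq> t)"

lemmas [simp] = mult_closed zero_closed zero_mult mult_zero

lemma sinv_inverse:
  assumes "x \<in> carrier S"
  shows "x\<^sup>- \<in> carrier S \<and> is_inverse S x (x\<^sup>-)"
  unfolding sinv_def by (rule theI'[OF ex1_inverse[OF assms]])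

lemma sinv_closed [simp]: "x \<in> carrier S \<Longrightarrow> x\<^sup>- \<in> carrier S"
  using sinv_inverse by blast

lemma mult_sinv_mult: "x \<in> carrier S \<Longrightarrow> x \<cdot> (x\<^sup>- \<cdot> x) = x"
  using sinv_inverse[of x] by (simp add: is_inverse_def mult_assoc)

lemma sinv_mult_sinv: "x \<in> carrier S \<Longrightarrow> x\<^sup>- \<cdot> (x \<cdot> x\<^sup>-) = x\<^sup>-"
  using sinv_inverse[of x] by (simp add: is_inverse_def mult_assoc)

lemma mult_sinv_mult_left [simp]:
  "x \<in> carrier S \<Longrightarrow> y \<in> carrier S \<Longrightarrow> x \<cdot> (x\<^sup>- \<cdot> (x \<cdot> y)) = x \<cdot> y"
  by (metis mult_assoc mult_closed mult_sinv_mult sinv_closed)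

lemma sinv_mult_sinv_left [simp]:
  "x \<in> carrier S \<Longrightarrow> y \<in> carrier S \<Longrightarrow> x\<^sup>- \<cdot> (x \<cdot> (x\<^sup>- \<cdot> y)) = x\<^sup>- \<cdot> y"
  by (metis mult_assoc mult_closed sinv_mult_sinv sinv_closed)

lemmas [simp] = mult_sinv_mult sinv_mult_sinv

lemma sinv_eqI:
  assumes "x \<in> carrier S" "y \<in> carrier S" "x \<cdot> (y \<cdot> x) = x" "y \<cdot> (x \<cdot> y) = y"
  shows "x\<^sup>- = y"
proof -
  have "is_inverse S x y"
    using assms by (simp add: is_inverse_def mult_assoc)
  then show ?thesis
    using ex1_inverse[OF assms(1)] sinv_inverse[OF assms(1)] assms(2) by blast
qed

lemma sinv_sinv [simp]: "x \<in> carrier S \<Longrightarrow> (x\<^sup>-)\<^sup>- = x"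
  by (intro sinv_eqI) auto

lemma idemI: "e \<in> carrier S \<Longrightarrow> e \<cdot> e = e \<Longrightarrow> idem e"
  by (simp add: idempotents_def)

lemma idem_closed [simp]: "idem e \<Longrightarrow> e \<in> carrier S"
  by (simp add: idempotents_def)

lemma idem_mult_self [simp]: "idem e \<Longrightarrow> e \<cdot> e = e"
  by (auto simp only: idempotents_def)

lemma idem_mult_self_left [simp]: "idem e \<Longrightarrow> x \<in> carrier S \<Longrightarrow> e \<cdot> (e \<cdot> x) = e \<cdot> x"
  by (simp flip: mult_assoc)

lemma idem_sinv [simp]: "idem e \<Longrightarrow> e\<^sup>- = e"
  by (intro sinv_eqI) auto

lemma idem_zero [simp]: "idem (szero S)"
  by (simp add: idemI)

text \<open>If \<open>x\<close> is the inverse of \<open>ef\<close>, then so is \<open>fxe\<close>, which is idempotent. Uniqueness of inverses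
  gives \<open>x = fxe\<close>, so \<open>x\<close> is idempotent and thus equal to its own inverse, which is \<open>ef\<close>.\<close>

lemma idem_mult [simp]:
  assumes "idem e" "idem f"
  shows "idem (e \<cdot> f)"
proof -
  define x where "x = (e \<cdot> f)\<^sup>-"
  have c [simp]: "e \<in> carrier S" "f \<in> carrier S" "x \<in> carrier S"
    using assms by (simp_all add: x_def)
  have 1: "e \<cdot> (f \<cdot> (x \<cdot> (e \<cdot> f))) = e \<cdot> f"
    using mult_sinv_mult[of "e \<cdot> f"] by (simp add: x_def[symmetric] mult_assoc)
  have 2: "x \<cdot> (e \<cdot> (f \<cdot> x)) = x"
    using sinv_mult_sinv[of "e \<cdot> f"] by (simp add: x_def[symmetric] mult_assoc)
  have 2: "x \<cdot> (e \<cdot> (f \<cdot> (x \<cdot> y))) = x \<cdot> y" if "y \<in> carrier S" for y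
    using that arg_cong[OF 2, of "\<lambda>t. t \<cdot> y"] by (simp add: mult_assoc)
  have "(e \<cdot> f)\<^sup>- = f \<cdot> (x \<cdot> e)"
    by (rule sinv_eqI) (use assms 1 2 in \<open>simp_all add: mult_assoc\<close>)
  then have "x = f \<cdot> (x \<cdot> e)"
    by (simp add: x_def)
  moreover have "idem (f \<cdot> (x \<cdot> e))"
    by (rule idemI) (use assms 2 in \<open>simp_all add: mult_assoc\<close>)
  ultimately have "idem x"
    by metis
  then have "x\<^sup>- = x" by simp
  then show ?thesis
    using \<open>idem x\<close> by (simp add: x_def)
qed

text \<open>Now \<open>ef\<close> and \<open>fe\<close> are both idempotent, which makes \<open>fe\<close> an inverse of the idempotent \<open>ef\<close>,
  whose only inverse is itself.\<close>

lemma idem_commute: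
  assumes "idem e" "idem f"
  shows "e \<cdot> f = f \<cdot> e"
proof -
  have 1: "e \<cdot> (f \<cdot> (e \<cdot> f)) = e \<cdot> f" "f \<cdot> (e \<cdot> (f \<cdot> e)) = f \<cdot> e"
    using idem_mult_self[of "e \<cdot> f"] idem_mult_self[of "f \<cdot> e"] assms
    by (simp_all add: mult_assoc del: idem_mult_self)
  have "(e \<cdot> f)\<^sup>- = f \<cdot> e"
    by (rule sinv_eqI) (use assms 1 in \<open>simp_all add: mult_assoc\<close>)
  then show ?thesis using assms by simp
qed

lemma idem_left_commute:
  assumes "idem e" "idem f" "x \<in> carrier S"
  shows "e \<cdot> (f \<cdot> x) = f \<cdot> (e \<cdot> x)"
  using assms by (simp add: idem_commute[of e f] flip: mult_assoc)

lemma idem_sinv_mult [simp]: "x \<in> carrier S \<Longrightarrow> idem (x\<^sup>- \<cdot> x)"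
  by (rule idemI) (simp_all add: mult_assoc)

lemma idem_mult_sinv [simp]: "x \<in> carrier S \<Longrightarrow> idem (x \<cdot> x\<^sup>-)"
  by (rule idemI) (simp_all add: mult_assoc)

lemma sinv_mult:
  assumes [simp]: "x \<in> carrier S" "y \<in> carrier S"
  shows "(x \<cdot> y)\<^sup>- = y\<^sup>- \<cdot> x\<^sup>-"
proof (rule sinv_eqI)
  have c: "(y \<cdot> y\<^sup>-) \<cdot> (x\<^sup>- \<cdot> x) = (x\<^sup>- \<cdot> x) \<cdot> (y \<cdot> y\<^sup>-)"
    by (simp add: idem_commute)
  have "x \<cdot> y \<cdot> (y\<^sup>- \<cdot> x\<^sup>- \<cdot> (x \<cdot> y)) = x \<cdot> ((y \<cdot> y\<^sup>-) \<cdot> (x\<^sup>- \<cdot> x)) \<cdot> y"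
    by (simp add: mult_assoc)
  also have "\<dots> = x \<cdot> y"
    by (simp only: c) (simp add: mult_assoc)
  finally show "x \<cdot> y \<cdot> (y\<^sup>- \<cdot> x\<^sup>- \<cdot> (x \<cdot> y)) = x \<cdot> y" .
  have "y\<^sup>- \<cdot> x\<^sup>- \<cdot> (x \<cdot> y \<cdot> (y\<^sup>- \<cdot> x\<^sup>-)) = y\<^sup>- \<cdot> ((x\<^sup>- \<cdot> x) \<cdot> (y \<cdot> y\<^sup>-)) \<cdot> x\<^sup>-"
    by (simp add: mult_assoc)
  also have "\<dots> = y\<^sup>- \<cdot> x\<^sup>-"
    by (simp only: c[symmetric]) (simp add: mult_assoc)
  finally show "y\<^sup>- \<cdot> x\<^sup>- \<cdot> (x \<cdot> y \<cdot> (y\<^sup>- \<cdot> x\<^sup>-)) = y\<^sup>- \<cdot> x\<^sup>-" .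
qed simp_all

lemma idem_conj:
  assumes "idem e" "x \<in> carrier S"
  shows "idem (x \<cdot> (e \<cdot> x\<^sup>-))"
proof -
  have "x \<cdot> (e \<cdot> x\<^sup>-) = (x \<cdot> e) \<cdot> (x \<cdot> e)\<^sup>-"
    using assms by (simp add: sinv_mult mult_assoc)
  then show ?thesis
    using assms by simp
qed

lemma nleD: "x \<preceq> y \<Longrightarrow> x \<in> carrier S \<Longrightarrow> y \<in> carrier S \<Longrightarrow> y \<cdot> (x\<^sup>- \<cdot> x) = x"
  by (simp add: nle_def mult_assoc)

lemma nle_mult_idem:
  assumes "y \<in> carrier S" "idem e"
  shows "y \<cdot> e \<preceq> y"
proof -
  let ?d = "y\<^sup>- \<cdot> y"
  have "(y \<cdot> e)\<^sup>- \<cdot> (y \<cdot> e) = e \<cdot> (?d \<cdot> e)"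
    using assms by (simp add: sinv_mult mult_assoc)
  also have "\<dots> = ?d \<cdot> e"
    using assms idem_commute[of ?d e] by simp
  finally have "y \<cdot> ((y \<cdot> e)\<^sup>- \<cdot> (y \<cdot> e)) = y \<cdot> e"
    using assms by (simp add: mult_assoc)
  then show ?thesis
    using assms by (simp add: nle_def mult_assoc)
qed

lemma nle_iff:
  assumes "x \<in> carrier S" "y \<in> carrier S"
  shows "x \<preceq> y \<longleftrightarrow> (\<exists>e. idem e \<and> x = y \<cdot> e)"
  using assms nleD nle_mult_idem by (metis idem_sinv_mult)

text \<open>An idempotent moves across an element by conjugation: \<open>y e = (y e y\<^sup>-\<^sup>1) y\<close>.\<close>

lemma nle_iff_left:
  assumes xy: "x \<in> carrier S" "y \<in> carrier S"
  shows "x \<preceq> y \<longleftrightarrow> (\<exists>e. idem e \<and> x = e \<cdot> y)"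
proof
  assume "x \<preceq> y"
  then obtain e where e: "idem e" "x = y \<cdot> e"
    using nle_iff xy by blast
  have "x = y \<cdot> ((y\<^sup>- \<cdot> y) \<cdot> e)"
    using e xy by (simp add: mult_assoc)
  also have "\<dots> = (y \<cdot> (e \<cdot> y\<^sup>-)) \<cdot> y"
    using e xy by (simp add: idem_commute[of _ e] mult_assoc)
  finally show "\<exists>e. idem e \<and> x = e \<cdot> y"
    using idem_conj e xy by blast
next
  assume "\<exists>e. idem e \<and> x = e \<cdot> y"
  then obtain e where e: "idem e" "x = e \<cdot> y" by blast
  have "x = (e \<cdot> (y \<cdot> y\<^sup>-)) \<cdot> y"
    using e xy by (simp add: mult_assoc)
  also have "\<dots> = y \<cdot> (y\<^sup>- \<cdot> (e \<cdot> (y\<^sup>-)\<^sup>-))"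
    using e xy by (simp add: idem_commute[of e "y \<cdot> y\<^sup>-"]) (simp add: mult_assoc)
  finally show "x \<preceq> y"
    using idem_conj[of e "y\<^sup>-"] e xy nle_iff by (metis sinv_closed)
qed

lemma nle_refl [simp]: "x \<in> carrier S \<Longrightarrow> x \<preceq> x"
  by (simp add: nle_def mult_assoc)

lemma nle_zero [simp]: "x \<in> carrier S \<Longrightarrow> szero S \<preceq> x"
  by (simp add: nle_def)

lemma nle_antisym:
  assumes "x \<preceq> y" "y \<preceq> x" "x \<in> carrier S" "y \<in> carrier S"
  shows "x = y"
proof -
  have 1: "y \<cdot> (x\<^sup>- \<cdot> x) = x" and 2: "x \<cdot> (y\<^sup>- \<cdot> y) = y"
    using assms nleD by auto
  have "y \<cdot> (x\<^sup>- \<cdot> x) = (x \<cdot> (y\<^sup>- \<cdot> y)) \<cdot> (x\<^sup>- \<cdot> x)"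
    by (simp only: 2)
  also have "\<dots> = x \<cdot> ((y\<^sup>- \<cdot> y) \<cdot> (x\<^sup>- \<cdot> x))"
    using assms by (simp add: mult_assoc)
  also have "\<dots> = x \<cdot> ((x\<^sup>- \<cdot> x) \<cdot> (y\<^sup>- \<cdot> y))"
    using assms idem_commute[of "y\<^sup>- \<cdot> y" "x\<^sup>- \<cdot> x"] by simp
  also have "\<dots> = x \<cdot> (y\<^sup>- \<cdot> y)"
    using assms by (simp add: mult_assoc)
  finally show ?thesis
    using 1 2 by metis
qed

lemma nle_trans:
  assumes "x \<preceq> y" "y \<preceq> z" "x \<in> carrier S" "y \<in> carrier S" "z \<in> carrier S"
  shows "x \<preceq> z"
proof -
  obtain e f where "idem e" "x = y \<cdot> e" "idem f" "y = z \<cdot> f"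
    using assms nle_iff by blast
  then have "idem (f \<cdot> e)" "x = z \<cdot> (f \<cdot> e)"
    using assms by (simp_all add: mult_assoc)
  then show ?thesis
    using nle_iff assms by blast
qed

lemma idem_nle_iff: "idem p \<Longrightarrow> idem q \<Longrightarrow> p \<preceq> q \<longleftrightarrow> q \<cdot> p = p"
  by (auto simp: nle_def mult_assoc)

lemma idem_of_nle: "x \<preceq> e \<Longrightarrow> idem e \<Longrightarrow> x \<in> carrier S \<Longrightarrow> idem x"
  using nle_iff[of x e] by auto

lemma nle_mult_right:
  assumes "x \<preceq> y" "x \<in> carrier S" "y \<in> carrier S" "z \<in> carrier S"
  shows "x \<cdot> z \<preceq> y \<cdot> z"
proof -
  obtain e where "idem e" "x = e \<cdot> y"
    using assms nle_iff_left by blast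
  then have "idem e \<and> x \<cdot> z = e \<cdot> (y \<cdot> z)"
    using assms by (simp add: mult_assoc)
  then show ?thesis
    using nle_iff_left assms mult_closed by blast
qed

lemma is_join_closed: "is_join x y s \<Longrightarrow> s \<in> carrier S"
  by (simp add: is_join_def)

lemma is_join_unique:
  assumes "is_join x y s" "is_join x y t"
  shows "s = t"
  using assms nle_antisym unfolding is_join_def by blast

lemma is_join_commute: "is_join x y s \<longleftrightarrow> is_join y x s"
  by (auto simp: is_join_def)

lemma is_join_zero: "x \<in> carrier S \<Longrightarrow> is_join x (szero S) x"
  by (simp add: is_join_def)

lemma least_natural_order_iff:
  assumes "x \<in> carrier S" "y \<in> carrier S"
  shows "least (natural_order S) s (Upper (natural_order S) {x, y}) \<longleftrightarrow> is_join x y s"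
  using assms
  by (auto simp: least_def Upper_def natural_order_def is_join_def nle_def)

lemma join_eqI:
  assumes "x \<in> carrier S" "y \<in> carrier S" "is_join x y s"
  shows "x \<squnion>\<^bsub>natural_order S\<^esub> y = s"
  unfolding join_def sup_def
  using assms is_join_unique by (auto simp: least_natural_order_iff)

end

lemma semigroup_hom_sinv:
  assumes S: "inverse_semigroup_zero S" and T: "inverse_semigroup_zero T"
    and f: "f \<in> carrier S \<rightarrow> carrier T"
      "\<And>x y. x \<in> carrier S \<Longrightarrow> y \<in> carrier S \<Longrightarrow> f (x \<cdot>\<^bsub>S\<^esub> y) = f x \<cdot>\<^bsub>T\<^esub> f y"
    and x: "x \<in> carrier S"
  shows "f (sinv S x) = sinv T (f x)"
proof -
  interpret S: inverse_semigroup_zero S by fact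
  interpret T: inverse_semigroup_zero T by fact
  have "f x \<cdot>\<^bsub>T\<^esub> (f (sinv S x) \<cdot>\<^bsub>T\<^esub> f x) = f (x \<cdot>\<^bsub>S\<^esub> (sinv S x \<cdot>\<^bsub>S\<^esub> x))"
    using f(2) x by (simp del: S.mult_sinv_mult)
  moreover have "f (sinv S x) \<cdot>\<^bsub>T\<^esub> (f x \<cdot>\<^bsub>T\<^esub> f (sinv S x)) = f (sinv S x \<cdot>\<^bsub>S\<^esub> (x \<cdot>\<^bsub>S\<^esub> sinv S x))"
    using f(2) x by (simp del: S.sinv_mult_sinv)
  ultimately show ?thesis
    using x f(1) by (intro T.sinv_eqI[symmetric]) auto
qed

section \<open>Orthogonal joins in a bias\<close>

context bias
begin

lemma ex_join:
  assumes "x \<in> carrier S" "y \<in> carrier S" "orthogonal S x y"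
  shows "\<exists>s. is_join x y s"
  using orthogonal_join[OF assms] least_natural_order_iff assms by blast

lemma idem_orthogonal: "idem p \<Longrightarrow> idem q \<Longrightarrow> p \<cdot> q = szero S \<Longrightarrow> orthogonal S p q"
  by (simp add: orthogonal_def)

lemma idem_join:
  assumes pq: "idem p" "idem q" "is_join p q w" and "idem r" "p \<preceq> r" "q \<preceq> r"
  shows "idem w" "w \<preceq> r"
  using assms idem_of_nle[of w r] by (auto simp: is_join_def)

abbreviation E_order :: "'a gorder"
  where "E_order \<equiv> (natural_order S)\<lparr>carrier := idempotents S\<rparr>"

interpretation E: generalized_boolean_algebra E_order
  by (rule idempotents_gba)

lemma E_le: "x \<sqsubseteq>\<^bsub>natural_order S\<^esub> y \<longleftrightarrow> x \<preceq> y"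
  by (simp add: natural_order_def nle_def)

lemma E_meet:
  assumes "idem p" "idem q"
  shows "p \<sqinter>\<^bsub>E_order\<^esub> q = p \<cdot> q"
proof -
  have pq: "p \<in> carrier E_order" "q \<in> carrier E_order"
    using assms by simp_all
  let ?m = "p \<sqinter>\<^bsub>E_order\<^esub> q"
  have m: "idem ?m"
    using E.meet_closed[OF pq] by simp
  have 1: "?m \<preceq> p" "?m \<preceq> q"
    using E.meet_left[OF pq] E.meet_right[OF pq] by (simp_all add: E_le)
  have "p \<cdot> q \<preceq> ?m"
  proof -
    have "p \<cdot> q \<preceq> p" "p \<cdot> q \<preceq> q"
      using assms nle_mult_idem[of p q] nle_mult_idem[of q p] by (simp_all add: idem_commute[of p q])
    then show ?thesis
      using E.meet_le[of "p \<cdot> q" p q] assms pq by (simp add: E_le)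
  qed
  moreover have "?m \<preceq> p \<cdot> q"
    using 1 m assms by (simp add: idem_nle_iff mult_assoc)
  ultimately show ?thesis
    using m assms by (intro nle_antisym) simp_all
qed

lemma E_bottom: "\<bottom>\<^bsub>E_order\<^esub> = szero S"
proof (rule nle_antisym)
  show "\<bottom>\<^bsub>E_order\<^esub> \<preceq> szero S"
    using E.bottom_lower[of "szero S"] by (simp add: E_le)
qed (use E.bottom_closed in auto)

text \<open>The lattice of idempotents only knows least upper bounds among idempotents. For orthogonal
  \<open>p, q\<close> they are least upper bounds in the whole semigroup: a join \<open>s\<close> in the semigroup exists and
  lies below the idempotent \<open>p \<squnion> q\<close>, and elements below an idempotent are idempotent.\<close>

lemma E_join:
  assumes "idem p" "idem q" "p \<cdot> q = szero S"
  shows "is_join p q (p \<squnion>\<^bsub>E_order\<^esub> q)"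
proof -
  let ?j = "p \<squnion>\<^bsub>E_order\<^esub> q"
  have pq: "p \<in> carrier E_order" "q \<in> carrier E_order"
    using assms by simp_all
  have j: "idem ?j"
    using E.join_closed[OF pq] by simp
  have 1: "p \<preceq> ?j" "q \<preceq> ?j"
    using E.join_left[OF pq] E.join_right[OF pq] by (simp_all add: E_le)
  obtain s where s: "is_join p q s"
    using ex_join idem_orthogonal assms by (meson idem_closed)
  have "idem s" "s \<preceq> ?j"
    using idem_join[OF assms(1,2) s j] 1 by auto
  moreover have "?j \<preceq> s"
    using E.join_le[of p s q] s pq \<open>idem s\<close> by (simp add: E_le is_join_def)
  ultimately show ?thesis
    using s j nle_antisym by (metis idem_closed)
qed

lemma ex_idem_join:
  assumes "idem p" "idem q" "p \<cdot> q = szero S"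
  shows "\<exists>w. idem w \<and> is_join p q w"
  using E_join[OF assms] E.join_closed[of p q] assms by auto

lemma idem_mult_join:
  assumes "idem p" "idem q" "p \<cdot> q = szero S" "is_join p q w" "idem r"
  shows "is_join (r \<cdot> p) (r \<cdot> q) (r \<cdot> w)"
proof -
  have w: "w = p \<squnion>\<^bsub>E_order\<^esub> q"
    using assms is_join_unique E_join by blast
  have "r \<cdot> w = (r \<cdot> p) \<squnion>\<^bsub>E_order\<^esub> (r \<cdot> q)"
    using E.meet_join_distrib[of r p q] assms(1,2,5) E.join_closed[of p q]
    by (simp add: E_meet w)
  moreover have "(r \<cdot> p) \<cdot> (r \<cdot> q) = r \<cdot> (p \<cdot> q)"
    using assms by (simp add: mult_assoc idem_left_commute[of p r])
  ultimately show ?thesis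
    using E_join[of "r \<cdot> p" "r \<cdot> q"] assms by simp
qed

lemma ex_idem_complement:
  assumes "idem p" "idem q" "p \<preceq> q"
  shows "\<exists>z. idem z \<and> p \<cdot> z = szero S \<and> is_join p z q"
proof -
  obtain z where "idem z" "p \<cdot> z = szero S" "p \<squnion>\<^bsub>E_order\<^esub> z = q"
    using E.relative_complement[of p q] assms E_meet E_bottom by (auto simp: E_le)
  then show ?thesis
    using E_join assms by blast
qed

lemma join_mult_idem:
  assumes x: "x \<in> carrier S" and y: "y \<in> carrier S" and t: "is_join x y t"
    and e: "idem e" "x \<cdot> e = x" "y \<cdot> e = y"
  shows "t \<cdot> e = t"
proof -
  have c: "t \<in> carrier S" and "x \<preceq> t" "y \<preceq> t"
    using t by (auto simp: is_join_def)
  then have "x \<preceq> t \<cdot> e" "y \<preceq> t \<cdot> e"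
    using nle_mult_right[of x t e] nle_mult_right[of y t e] x y e by auto
  then have "t \<preceq> t \<cdot> e"
    using t c e by (auto simp: is_join_def)
  then show ?thesis
    using nle_mult_idem[of t e] nle_antisym c e by auto
qed

text \<open>This is the part of right distributivity that reading off columns requires. The domain
  idempotents of \<open>x\<close> and \<open>y\<close> are orthogonal and their join \<open>w\<close> satisfies \<open>t w = t\<close>. Distributivity
  among idempotents turns \<open>w g\<close> into \<open>x\<^sup>-\<^sup>1 x g\<close>, and \<open>t x\<^sup>-\<^sup>1 x = x\<close> since \<open>x \<preceq> t\<close>.\<close>

lemma join_mult_idem_disjoint:
  assumes x: "x \<in> carrier S" and y: "y \<in> carrier S" and o: "orthogonal S x y"
    and t: "is_join x y t" and g: "idem g" "y \<cdot> g = szero S"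
  shows "t \<cdot> g = x \<cdot> g"
proof -
  let ?p = "x\<^sup>- \<cdot> x" and ?q = "y\<^sup>- \<cdot> y"
  have p: "idem ?p" and q: "idem ?q" using x y by simp_all
  have c: "t \<in> carrier S" and xt: "x \<preceq> t"
    using t by (auto simp: is_join_def)
  have "?p \<cdot> ?q = x\<^sup>- \<cdot> ((x \<cdot> y\<^sup>-) \<cdot> y)"
    using x y by (simp add: mult_assoc)
  then have pq: "?p \<cdot> ?q = szero S"
    using o x y by (simp add: orthogonal_def)
  obtain w where w: "idem w" "is_join ?p ?q w"
    using ex_idem_join p q pq by blast
  have wp: "?p \<cdot> w = ?p" and wq: "?q \<cdot> w = ?q"
    using w p q by (auto simp: is_join_def idem_nle_iff idem_commute[of _ w])
  have "x \<cdot> w = x \<cdot> (?p \<cdot> w)" "y \<cdot> w = y \<cdot> (?q \<cdot> w)"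
    using x y w by (simp_all add: mult_assoc)
  then have tw: "t \<cdot> w = t"
    using join_mult_idem[OF x y t w(1)] x y wp wq by simp
  have "g \<cdot> ?q = ?q \<cdot> g"
    using idem_commute g q by blast
  then have gq: "g \<cdot> ?q = szero S"
    using g y by (simp add: mult_assoc)
  have "is_join (g \<cdot> ?p) (g \<cdot> ?q) (g \<cdot> w)"
    by (rule idem_mult_join[OF p q pq w(2) g(1)])
  then have gw: "g \<cdot> w = g \<cdot> ?p"
    using gq is_join_zero is_join_unique g p by (metis idem_closed idem_mult)
  have "t \<cdot> g = t \<cdot> (w \<cdot> g)"
    using tw c w g by (metis idem_closed mult_assoc)
  also have "\<dots> = t \<cdot> (?p \<cdot> g)"
    using gw idem_commute w g p by metis
  also have "\<dots> = x \<cdot> g"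
    using nleD[OF xt x c] c g p by (metis idem_closed mult_assoc)
  finally show ?thesis .
qed

text \<open>The element \<open>x\<^sup>-\<^sup>1 y\<close> lies above \<open>x\<^sup>-\<^sup>1 x p\<close> and \<open>x\<^sup>-\<^sup>1 x q\<close>, hence above their join, which
  is \<open>x\<^sup>-\<^sup>1 x w\<close>. Multiplying by \<open>x\<close> on the left shows that \<open>x w\<close> is a restriction of \<open>y w\<close>.\<close>

lemma eq_on_join_le:
  assumes x: "x \<in> carrier S" and y: "y \<in> carrier S" and pq: "idem p" "idem q" "p \<cdot> q = szero S"
    and w: "idem w" "is_join p q w" and eq: "x \<cdot> p = y \<cdot> p" "x \<cdot> q = y \<cdot> q"
  shows "x \<cdot> w \<preceq> y \<cdot> w"
proof -
  let ?k = "x\<^sup>- \<cdot> x" and ?h = "x\<^sup>- \<cdot> y"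
  have k: "idem ?k" and h: "?h \<in> carrier S" using x y by simp_all
  have "?k \<cdot> p \<preceq> ?h" "?k \<cdot> q \<preceq> ?h"
    using eq x y pq nle_mult_idem[OF h] by (simp_all add: mult_assoc)
  then have "?k \<cdot> w \<preceq> ?h"
    using idem_mult_join[OF pq w(2) k] h by (auto simp: is_join_def)
  then have "?h \<cdot> (?k \<cdot> w) = ?k \<cdot> w"
    using nleD[of "?k \<cdot> w" ?h] k w h by simp
  then have "x \<cdot> (?h \<cdot> (?k \<cdot> w)) = x \<cdot> (?k \<cdot> w)"
    by simp
  then have "x \<cdot> w = (x \<cdot> x\<^sup>-) \<cdot> (y \<cdot> (?k \<cdot> w))"
    using x y w by (simp add: mult_assoc)
  also have "\<dots> = (x \<cdot> x\<^sup>-) \<cdot> ((y \<cdot> w) \<cdot> ?k)"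
    using x y w by (subst idem_commute[OF k w(1)]) (simp add: mult_assoc)
  finally have "x \<cdot> w = (x \<cdot> x\<^sup>-) \<cdot> ((y \<cdot> w) \<cdot> ?k)" .
  moreover have "(x \<cdot> x\<^sup>-) \<cdot> ((y \<cdot> w) \<cdot> ?k) \<preceq> (y \<cdot> w) \<cdot> ?k"
    using nle_iff_left x y w k by (metis idem_closed idem_mult_sinv mult_closed)
  moreover have "(y \<cdot> w) \<cdot> ?k \<preceq> y \<cdot> w"
    using nle_mult_idem x y w k by simp
  ultimately show ?thesis
    using nle_trans[of "x \<cdot> w" "(y \<cdot> w) \<cdot> ?k" "y \<cdot> w"] x y w k by simp
qed

lemma eq_on_join:
  assumes "x \<in> carrier S" "y \<in> carrier S" "idem p" "idem q" "p \<cdot> q = szero S"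
    and "idem w" "is_join p q w" "x \<cdot> p = y \<cdot> p" "x \<cdot> q = y \<cdot> q"
  shows "x \<cdot> w = y \<cdot> w"
  using assms eq_on_join_le[of x y p q w] eq_on_join_le[of y x p q w] by (intro nle_antisym) simp_all

end

section \<open>Matrix units and the elements they generate\<close>

lemma map_eqI:
  assumes "\<And>x y. f x = Some y \<longleftrightarrow> g x = Some y"
  shows "f = g"
proof
  fix x
  show "f x = g x"
    using assms[of x "the (f x)"] assms[of x "the (g x)"] by (cases "f x"; cases "g x") auto
qed

definition partial_bij :: "'i set \<Rightarrow> ('i \<rightharpoonup> 'i) \<Rightarrow> bool"
  where "partial_bij I f \<longleftrightarrow> dom f \<subseteq> I \<and> ran f \<subseteq> I \<and> inj_on f (dom f)"

lemma partial_bijD: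
  assumes "partial_bij I f" "f x = Some y"
  shows "x \<in> I" "y \<in> I"
  using assms by (auto simp: partial_bij_def dom_def ran_def)

lemma partial_bij_inj:
  assumes "partial_bij I f" "f x = Some z" "f y = Some z"
  shows "x = y"
  using assms unfolding partial_bij_def inj_on_def by (metis domI)

lemma partial_bijI:
  assumes "\<And>x y. f x = Some y \<Longrightarrow> x \<in> I \<and> y \<in> I"
    and "\<And>x y z. f x = Some z \<Longrightarrow> f y = Some z \<Longrightarrow> x = y"
  shows "partial_bij I f"
  using assms unfolding partial_bij_def inj_on_def dom_def ran_def by auto

lemma partial_bij_comp:
  assumes "partial_bij I f" "partial_bij I g"
  shows "partial_bij I (f \<circ>\<^sub>m g)"
  by (rule partial_bijI)
     (use assms in \<open>auto simp: map_comp_Some_iff dest: partial_bijD partial_bij_inj\<close>)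

locale matrix_units = bias S for S (structure) +
  fixes I :: "'i set" and u :: "'i \<Rightarrow> 'i \<Rightarrow> 'a"
  assumes finite_index: "finite I"
    and unit_closed [simp]: "i \<in> I \<Longrightarrow> j \<in> I \<Longrightarrow> u i j \<in> carrier S"
    and unit_mult: "i \<in> I \<Longrightarrow> j \<in> I \<Longrightarrow> k \<in> I \<Longrightarrow> l \<in> I \<Longrightarrow>
      u i j \<cdot> u k l = (if j = k then u i l else szero S)"
begin

lemma unit_idem [simp]: "i \<in> I \<Longrightarrow> idem (u i i)"
  by (rule idemI) (simp_all add: unit_mult)

lemma unit_sinv: "i \<in> I \<Longrightarrow> j \<in> I \<Longrightarrow> (u i j)\<^sup>- = u j i"
  by (rule sinv_eqI) (simp_all add: unit_mult)

text \<open>The idempotent \<open>e\<close> is the join of the \<open>u j j\<close> for \<open>j \<in> A\<close>. The equality principle in the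
  statement also supplies, in the induction step, the orthogonality of \<open>e\<close> to the next \<open>u k k\<close>:
  \<open>u k k\<close> and \<open>0\<close> agree on every \<open>u j j\<close> with \<open>j \<in> A\<close>, hence on \<open>e\<close>.\<close>

lemma ex_diagonal_sum:
  assumes "finite A" "A \<subseteq> I"
  shows "\<exists>e. idem e \<and> (\<forall>j\<in>A. u j j \<preceq> e) \<and>
    (\<forall>x\<in>carrier S. \<forall>y\<in>carrier S. (\<forall>j\<in>A. x \<cdot> u j j = y \<cdot> u j j) \<longrightarrow> x \<cdot> e = y \<cdot> e)"
  using assms
proof (induction A rule: finite_induct)
  case empty
  then show ?case
    by (intro exI[of _ "szero S"]) simp
next
  case (insert k A)
  then obtain e where e: "idem e" "\<forall>j\<in>A. u j j \<preceq> e"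
    and eq: "\<And>x y. x \<in> carrier S \<Longrightarrow> y \<in> carrier S \<Longrightarrow>
      (\<forall>j\<in>A. x \<cdot> u j j = y \<cdot> u j j) \<Longrightarrow> x \<cdot> e = y \<cdot> e"
    by blast
  have k: "k \<in> I" and A: "\<And>j. j \<in> A \<Longrightarrow> j \<in> I"
    using insert by auto
  have "\<forall>j\<in>A. u k k \<cdot> u j j = szero S \<cdot> u j j"
    using k A insert.hyps by (auto simp: unit_mult)
  then have "u k k \<cdot> e = szero S \<cdot> e"
    using k eq by simp
  then have 0: "e \<cdot> u k k = szero S"
    using idem_commute[of e "u k k"] e k by simp
  obtain w where w: "idem w" "is_join e (u k k) w"
    using ex_idem_join[OF e(1) _ 0] k by auto
  have "\<forall>j\<in>insert k A. u j j \<preceq> w"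
  proof
    fix j assume j: "j \<in> insert k A"
    have "e \<preceq> w" "u k k \<preceq> w"
      using w by (auto simp: is_join_def)
    then show "u j j \<preceq> w"
      using j e k A w nle_trans[of "u j j" e w] by auto
  qed
  moreover have "x \<cdot> w = y \<cdot> w"
    if "x \<in> carrier S" "y \<in> carrier S" "\<forall>j\<in>insert k A. x \<cdot> u j j = y \<cdot> u j j" for x y
    using eq_on_join[OF that(1,2) e(1) _ 0 w] eq[OF that(1,2)] that(3) k by simp
  ultimately show ?case
    using w(1) by blast
qed

definition diagonal_sum :: 'a
  where "diagonal_sum = (SOME e. idem e \<and> (\<forall>j\<in>I. u j j \<preceq> e) \<and>
    (\<forall>x\<in>carrier S. \<forall>y\<in>carrier S. (\<forall>j\<in>I. x \<cdot> u j j = y \<cdot> u j j) \<longrightarrow> x \<cdot> e = y \<cdot> e))"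

lemma diagonal_sum:
  shows diagonal_sum_idem [simp]: "idem diagonal_sum"
    and unit_le_diagonal_sum: "j \<in> I \<Longrightarrow> u j j \<preceq> diagonal_sum"
    and eq_on_diagonal_sum: "x \<in> carrier S \<Longrightarrow> y \<in> carrier S \<Longrightarrow>
      (\<And>j. j \<in> I \<Longrightarrow> x \<cdot> u j j = y \<cdot> u j j) \<Longrightarrow> x \<cdot> diagonal_sum = y \<cdot> diagonal_sum"
  using someI_ex[OF ex_diagonal_sum[OF finite_index subset_refl]]
  unfolding diagonal_sum_def[symmetric] by blast+

definition column :: "('i \<rightharpoonup> 'i) \<Rightarrow> 'i \<Rightarrow> 'a"
  where "column f j = (case f j of None \<Rightarrow> szero S | Some i \<Rightarrow> u i j)"

text \<open>The element \<open>s\<close> plays the role of the orthogonal join of the \<open>u i j\<close> with \<open>f j = Some i\<close>; it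
  is specified by its columns so that no finite joins have to be multiplied out.\<close>

definition represents :: "('i \<rightharpoonup> 'i) \<Rightarrow> 'a \<Rightarrow> bool"
  where "represents f s \<longleftrightarrow> s \<in> carrier S \<and> s \<cdot> diagonal_sum = s \<and>
    (\<forall>j\<in>I. s \<cdot> u j j = column f j)"

lemma represents_closed: "represents f s \<Longrightarrow> s \<in> carrier S"
  by (simp add: represents_def)

lemma represents_unique:
  assumes "represents f s" "represents f t"
  shows "s = t"
  using assms eq_on_diagonal_sum[of s t] by (simp add: represents_def)


lemma represents_mult_unit:
  assumes f: "partial_bij I f" and s: "represents f s" and kj: "k \<in> I" "j \<in> I"
  shows "s \<cdot> u k j = (case f k of None \<Rightarrow> szero S | Some i \<Rightarrow> u i j)"
proof -
  have "s \<cdot> u k j = s \<cdot> (u k k \<cdot> u k j)"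
    using kj by (simp add: unit_mult)
  also have "\<dots> = column f k \<cdot> u k j"
    using s kj by (simp add: represents_def flip: mult_assoc)
  also have "\<dots> = (case f k of None \<Rightarrow> szero S | Some i \<Rightarrow> u i j)"
    using kj f by (auto simp: column_def unit_mult partial_bijD split: option.split)
  finally show ?thesis .
qed

lemma represents_zero: "represents Map.empty (szero S)"
  by (auto simp: represents_def column_def)

lemma represents_mult:
  assumes f: "partial_bij I f" "represents f s" and g: "partial_bij I g" "represents g t"
  shows "represents (f \<circ>\<^sub>m g) (s \<cdot> t)"
proof -
  have c: "s \<in> carrier S" "t \<in> carrier S"
    using f g represents_closed by auto
  have "(s \<cdot> t) \<cdot> u j j = column (f \<circ>\<^sub>m g) j" if j: "j \<in> I" for j
  proof -
    have "(s \<cdot> t) \<cdot> u j j = s \<cdot> column g j"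
      using g c j by (simp add: represents_def mult_assoc)
    also have "\<dots> = column (f \<circ>\<^sub>m g) j"
      using represents_mult_unit[OF f _ j] partial_bijD[OF g(1)] c
      by (auto simp: column_def map_comp_def split: option.split)
    finally show ?thesis .
  qed
  moreover have "(s \<cdot> t) \<cdot> diagonal_sum = s \<cdot> t"
    using g c by (simp add: represents_def mult_assoc)
  ultimately show ?thesis
    using c by (simp add: represents_def)
qed

text \<open>At most one of \<open>s\<close>, \<open>t\<close> has a nonzero column at a given index, and lemma
  \<open>join_mult_idem_disjoint\<close> says that the join has the same column there.\<close>

lemma represents_join:
  assumes f: "represents f s" and g: "represents g t" and fg: "dom f \<inter> dom g = {}"
    and o: "orthogonal S s t" and r: "is_join s t r"
  shows "represents (f ++ g) r"
proof -
  have c: "s \<in> carrier S" "t \<in> carrier S" "r \<in> carrier S"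
    using f g r represents_closed is_join_closed by auto
  have o': "orthogonal S t s"
  proof -
    have "t\<^sup>- \<cdot> s = (s\<^sup>- \<cdot> t)\<^sup>-" "t \<cdot> s\<^sup>- = (s \<cdot> t\<^sup>-)\<^sup>-"
      using c by (simp_all add: sinv_mult)
    then show ?thesis
      using o by (simp add: orthogonal_def)
  qed
  have r': "is_join t s r"
    using r is_join_commute by blast
  have "r \<cdot> u j j = column (f ++ g) j" if j: "j \<in> I" for j
  proof (cases "g j")
    case None
    then have "t \<cdot> u j j = szero S" "column (f ++ g) j = column f j"
      using g j by (simp_all add: represents_def column_def map_add_def)
    then show ?thesis
      using join_mult_idem_disjoint[OF c(1,2) o r] f j by (simp add: represents_def)
  next
    case (Some i)
    then have "f j = None"
      using fg by blast
    then have "s \<cdot> u j j = szero S" "column (f ++ g) j = column g j"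
      using f j Some by (simp_all add: represents_def column_def map_add_def)
    then show ?thesis
      using join_mult_idem_disjoint[OF c(2,1) o' r'] g j by (simp add: represents_def)
  qed
  moreover have "r \<cdot> diagonal_sum = r"
    using join_mult_idem[OF c(1,2) r] f g by (simp add: represents_def)
  ultimately show ?thesis
    using c by (simp add: represents_def)
qed

lemma represents_unit:
  assumes ik: "i \<in> I" "k \<in> I"
  shows "represents [k \<mapsto> i] (u i k)"
proof -
  have "u i k \<cdot> diagonal_sum = u i k \<cdot> (u k k \<cdot> diagonal_sum)"
    using ik by (simp add: unit_mult flip: mult_assoc)
  also have "u k k \<cdot> diagonal_sum = u k k"
    using ik unit_le_diagonal_sum[of k] by (simp add: idem_nle_iff idem_commute[of "u k k"])
  finally show ?thesis
    using ik by (simp add: represents_def column_def unit_mult)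
qed

text \<open>The values of \<open>f\<close> are added one at a time. Orthogonality of the new unit \<open>u i k\<close> to the element
  \<open>s\<close> built so far is again read off columns: \<open>u k i \<cdot> s\<close> has only zero columns because \<open>f\<close>, being
  injective, does not take the value \<open>i\<close> elsewhere, while \<open>s \<cdot> u k i\<close> vanishes because \<open>s\<close> has a zero
  column at \<open>k\<close>.\<close>

lemma ex_represents:
  assumes f: "partial_bij I f"
  shows "\<exists>s. represents f s"
proof -
  have "A \<subseteq> dom f \<Longrightarrow> \<exists>s. represents (f |` A) s" if "finite A" for A
    using that
  proof (induction A rule: finite_induct)
    case empty
    then show ?case
      using represents_zero by auto
  next
    case (insert k A)
    then obtain s i where s: "represents (f |` A) s" and i: "f k = Some i"
      by auto
    have ik: "i \<in> I" "k \<in> I"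
      using partial_bijD[OF f i] by auto
    have c: "s \<in> carrier S" "u i k \<in> carrier S"
      using represents_closed[OF s] ik by auto
    have A: "partial_bij I (f |` A)"
      by (rule partial_bijI) (use f in \<open>auto simp: restrict_map_def dest: partial_bijD
        partial_bij_inj split: if_splits\<close>)
    have "(u k i \<cdot> s) \<cdot> u j j = szero S \<cdot> u j j" if j: "j \<in> I" for j
    proof -
      have "(u k i \<cdot> s) \<cdot> u j j = u k i \<cdot> column (f |` A) j"
        using s c ik j by (simp add: represents_def mult_assoc)
      moreover have "i \<noteq> l" if "(f |` A) j = Some l" for l
        using that i insert.hyps partial_bij_inj[OF f i, of j]
        by (auto simp: restrict_map_def split: if_splits)
      ultimately show ?thesis
        using ik j partial_bijD[OF A] by (auto simp: column_def unit_mult split: option.split)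
    qed
    then have "(u k i \<cdot> s) \<cdot> diagonal_sum = szero S \<cdot> diagonal_sum"
      using c ik by (intro eq_on_diagonal_sum) auto
    then have 1: "u k i \<cdot> s = szero S"
      using s c ik by (simp add: represents_def mult_assoc)
    have 2: "s \<cdot> u k i = szero S"
      using represents_mult_unit[OF A s, of k i] ik insert.hyps by simp
    have "u i k \<cdot> s\<^sup>- = (s \<cdot> u k i)\<^sup>-"
      using c ik by (simp add: sinv_mult unit_sinv)
    then have o: "orthogonal S (u i k) s"
      using 1 2 ik by (simp add: orthogonal_def unit_sinv)
    obtain r where "is_join (u i k) s r"
      using ex_join[OF c(2,1) o] by blast
    then have "represents ([k \<mapsto> i] ++ f |` A) r"
      using represents_join[OF represents_unit[OF ik] s _ o] insert.hyps by auto
    moreover have "[k \<mapsto> i] ++ f |` A = f |` insert k A"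
      using i insert.hyps by (auto simp: map_add_def restrict_map_def split: option.split)
    ultimately show ?case
      by auto
  qed
  moreover have "finite (dom f)"
    using f finite_index finite_subset unfolding partial_bij_def by blast
  moreover have "f |` dom f = f"
    by (auto simp: restrict_map_def dom_def)
  ultimately show ?thesis
    by (metis subset_refl)
qed

definition matrix_elem :: "('i \<rightharpoonup> 'i) \<Rightarrow> 'a"
  where "matrix_elem f = (SOME s. represents f s)"

lemma represents_matrix_elem: "partial_bij I f \<Longrightarrow> represents f (matrix_elem f)"
  unfolding matrix_elem_def by (rule someI_ex[OF ex_represents])

lemma matrix_elem_eq: "represents f s \<Longrightarrow> matrix_elem f = s"
  unfolding matrix_elem_def using represents_unique by (metis someI)

end

text \<open>The elements \<open>y i \<cdot> d\<close> have the common domain idempotent \<open>d\<close> and orthogonal ranges; the units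
  are \<open>(y i \<cdot> d) \<cdot> (y j \<cdot> d)\<^sup>-\<close>.\<close>

lemma (in bias) matrix_units_of_orthogonal_ranges:
  assumes I: "finite I" and y: "\<And>i. i \<in> I \<Longrightarrow> y i \<in> carrier S" and d: "idem d"
    and rd: "\<And>i. i \<in> I \<Longrightarrow> (y i)\<^sup>- \<cdot> y i \<cdot> d = d"
    and o: "\<And>i j. i \<in> I \<Longrightarrow> j \<in> I \<Longrightarrow> i \<noteq> j \<Longrightarrow> (y i)\<^sup>- \<cdot> y j = szero S"
  shows "matrix_units S I (\<lambda>i j. y i \<cdot> (d \<cdot> (y j)\<^sup>-))"
proof -
  let ?u = "\<lambda>i j. y i \<cdot> (d \<cdot> (y j)\<^sup>-)"
  have "?u i j \<cdot> ?u k l = (if j = k then ?u i l else szero S)"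
    if ij: "i \<in> I" "j \<in> I" and kl: "k \<in> I" "l \<in> I" for i j k l
  proof -
    have "?u i j \<cdot> ?u k l = y i \<cdot> (d \<cdot> (((y j)\<^sup>- \<cdot> y k) \<cdot> (d \<cdot> (y l)\<^sup>-)))"
      using ij kl y d by (simp add: mult_assoc)
    also have "\<dots> = (if j = k then ?u i l else szero S)"
    proof (cases "j = k")
      case True
      have "((y k)\<^sup>- \<cdot> y k) \<cdot> (d \<cdot> (y l)\<^sup>-) = (y k)\<^sup>- \<cdot> y k \<cdot> d \<cdot> (y l)\<^sup>-"
        using kl y d by (simp add: mult_assoc)
      then show ?thesis
        using True ij kl y d by (simp add: rd)
    next
      case False
      then show ?thesis
        using ij kl y d o[of j k] by simp
    qed
    finally show ?thesis .
  qed
  then show ?thesis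
    using I y d by unfold_locales auto
qed

section \<open>Lifting orthogonal idempotents and matrix units\<close>

locale bias_homomorphism = S: bias S + T: bias T
  for S :: "('a, 'm) semigroup_zero_scheme" and T :: "('b, 'n) semigroup_zero_scheme" +
  fixes \<phi> :: "'a \<Rightarrow> 'b"
  assumes hom: "\<phi> \<in> bias_hom S T"
begin

lemma hom_closed [simp]: "x \<in> carrier S \<Longrightarrow> \<phi> x \<in> carrier T"
  using hom by (auto simp: bias_hom_def)

lemma hom_mult [simp]:
  "x \<in> carrier S \<Longrightarrow> y \<in> carrier S \<Longrightarrow> \<phi> (x \<cdot>\<^bsub>S\<^esub> y) = \<phi> x \<cdot>\<^bsub>T\<^esub> \<phi> y"
  using hom by (auto simp: bias_hom_def)

lemma hom_zero [simp]: "\<phi> (szero S) = szero T"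
  using hom by (auto simp: bias_hom_def)

lemma hom_join:
  "x \<in> carrier S \<Longrightarrow> y \<in> carrier S \<Longrightarrow> orthogonal S x y \<Longrightarrow>
    \<phi> (x \<squnion>\<^bsub>natural_order S\<^esub> y) = \<phi> x \<squnion>\<^bsub>natural_order T\<^esub> \<phi> y"
  using hom by (simp add: bias_hom_def)

lemma hom_sinv [simp]: "x \<in> carrier S \<Longrightarrow> \<phi> (sinv S x) = sinv T (\<phi> x)"
  by (rule semigroup_hom_sinv)
     (use S.inverse_semigroup_zero_axioms T.inverse_semigroup_zero_axioms in auto)

lemma hom_idem [simp]: "S.idem p \<Longrightarrow> T.idem (\<phi> p)"
  by (rule T.idemI) (simp_all flip: hom_mult)

text \<open>Take the complement of \<open>p q\<close> in \<open>p\<close>. Then \<open>p\<close> is the orthogonal join of \<open>p q\<close> and \<open>z\<close>, so by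
  additivity \<open>\<phi> p\<close> is the join of \<open>\<phi> (p q) = 0\<close> and \<open>\<phi> z\<close>. This is the step that uses additivity of
  \<open>\<phi>\<close>.\<close>

lemma ex_disjoint_part:
  assumes pq: "S.idem p" "S.idem q" and 0: "\<phi> p \<cdot>\<^bsub>T\<^esub> \<phi> q = szero T"
  shows "\<exists>z. S.idem z \<and> p \<cdot>\<^bsub>S\<^esub> z = z \<and> \<phi> z = \<phi> p \<and> z \<cdot>\<^bsub>S\<^esub> q = szero S"
proof -
  have pq': "S.idem (p \<cdot>\<^bsub>S\<^esub> q)" "S.nle (p \<cdot>\<^bsub>S\<^esub> q) p"
    using pq S.nle_mult_idem[of p q] by simp_all
  obtain z where z: "S.idem z" "p \<cdot>\<^bsub>S\<^esub> q \<cdot>\<^bsub>S\<^esub> z = szero S"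
      "S.is_join (p \<cdot>\<^bsub>S\<^esub> q) z p"
    using S.ex_idem_complement[OF pq'(1) pq(1) pq'(2)] by blast
  have pz: "p \<cdot>\<^bsub>S\<^esub> z = z"
    using z pq by (auto simp: S.is_join_def S.idem_nle_iff)
  have "z \<cdot>\<^bsub>S\<^esub> q = (p \<cdot>\<^bsub>S\<^esub> z) \<cdot>\<^bsub>S\<^esub> q"
    by (simp only: pz)
  also have "\<dots> = p \<cdot>\<^bsub>S\<^esub> q \<cdot>\<^bsub>S\<^esub> z"
    using z(1) pq by (simp add: S.mult_assoc S.idem_commute[of z q])
  finally have zq: "z \<cdot>\<^bsub>S\<^esub> q = szero S"
    using z(2) by simp
  have "orthogonal S (p \<cdot>\<^bsub>S\<^esub> q) z"
    using z pq' S.idem_orthogonal by blast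
  moreover have "(p \<cdot>\<^bsub>S\<^esub> q) \<squnion>\<^bsub>natural_order S\<^esub> z = p"
    using S.join_eqI z pq' by simp
  ultimately have "\<phi> p = \<phi> (p \<cdot>\<^bsub>S\<^esub> q) \<squnion>\<^bsub>natural_order T\<^esub> \<phi> z"
    using hom_join[of "p \<cdot>\<^bsub>S\<^esub> q" z] z(1) pq'(1) by simp
  also have "\<dots> = \<phi> z"
  proof (rule T.join_eqI)
    show "T.is_join (\<phi> (p \<cdot>\<^bsub>S\<^esub> q)) (\<phi> z) (\<phi> z)"
      using T.is_join_zero[of "\<phi> z"] T.is_join_commute[of "\<phi> z" "szero T"] 0 pq z(1) by simp
  qed (use pq z in simp_all)
  finally show ?thesis
    using z(1) pz zq by auto
qed

lemma ex_disjoint_part_finite: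
  assumes "finite A" "S.idem p" "\<And>i. i \<in> A \<Longrightarrow> S.idem (q i)"
    and "\<And>i. i \<in> A \<Longrightarrow> \<phi> p \<cdot>\<^bsub>T\<^esub> \<phi> (q i) = szero T"
  shows "\<exists>z. S.idem z \<and> p \<cdot>\<^bsub>S\<^esub> z = z \<and> \<phi> z = \<phi> p \<and> (\<forall>i\<in>A. z \<cdot>\<^bsub>S\<^esub> q i = szero S)"
  using assms
proof (induction A rule: finite_induct)
  case empty
  then show ?case
    by (intro exI[of _ p]) simp
next
  case (insert k A)
  then obtain z where z: "S.idem z" "p \<cdot>\<^bsub>S\<^esub> z = z" "\<phi> z = \<phi> p"
      "\<And>i. i \<in> A \<Longrightarrow> z \<cdot>\<^bsub>S\<^esub> q i = szero S"
    by auto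
  then obtain y where y: "S.idem y" "z \<cdot>\<^bsub>S\<^esub> y = y" "\<phi> y = \<phi> z" "y \<cdot>\<^bsub>S\<^esub> q k = szero S"
    using ex_disjoint_part[of z "q k"] insert.prems by auto
  have "p \<cdot>\<^bsub>S\<^esub> y = p \<cdot>\<^bsub>S\<^esub> (z \<cdot>\<^bsub>S\<^esub> y)"
    by (simp only: y(2))
  also have "\<dots> = (p \<cdot>\<^bsub>S\<^esub> z) \<cdot>\<^bsub>S\<^esub> y"
    using z(1) y(1) insert.prems(1) by (simp add: S.mult_assoc)
  finally have "p \<cdot>\<^bsub>S\<^esub> y = y"
    using z(2) y(2) by simp
  moreover have "y \<cdot>\<^bsub>S\<^esub> q i = szero S" if "i \<in> A" for i
  proof -
    have "y \<cdot>\<^bsub>S\<^esub> q i = (y \<cdot>\<^bsub>S\<^esub> z) \<cdot>\<^bsub>S\<^esub> q i"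
      using y z S.idem_commute[of y z] by simp
    also have "\<dots> = y \<cdot>\<^bsub>S\<^esub> (z \<cdot>\<^bsub>S\<^esub> q i)"
      using y(1) z(1) insert.prems(2) that by (simp add: S.mult_assoc)
    finally show ?thesis
      using z that y(1) by simp
  qed
  ultimately show ?case
    using y z(3) by (intro exI[of _ y]) auto
qed

text \<open>The elements are corrected one at a time: \<open>x k\<close> is restricted on the left to a part of its
  range disjoint from the ranges already treated.\<close>

lemma ex_orthogonal_ranges:
  assumes "finite A" "\<And>i. i \<in> A \<Longrightarrow> x i \<in> carrier S"
    and "\<And>i j. i \<in> A \<Longrightarrow> j \<in> A \<Longrightarrow> i \<noteq> j \<Longrightarrow> sinv T (\<phi> (x i)) \<cdot>\<^bsub>T\<^esub> \<phi> (x j) = szero T"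
  shows "\<exists>y. (\<forall>i\<in>A. y i \<in> carrier S \<and> \<phi> (y i) = \<phi> (x i)) \<and>
    (\<forall>i\<in>A. \<forall>j\<in>A. i \<noteq> j \<longrightarrow> sinv S (y i) \<cdot>\<^bsub>S\<^esub> y j = szero S)"
  using assms
proof (induction A rule: finite_induct)
  case empty
  then show ?case by simp
next
  case (insert k A)
  have "\<exists>y. (\<forall>i\<in>A. y i \<in> carrier S \<and> \<phi> (y i) = \<phi> (x i)) \<and>
      (\<forall>i\<in>A. \<forall>j\<in>A. i \<noteq> j \<longrightarrow> sinv S (y i) \<cdot>\<^bsub>S\<^esub> y j = szero S)"
    by (rule insert.IH) (use insert.prems in blast)+
  then obtain y where y: "\<And>i. i \<in> A \<Longrightarrow> y i \<in> carrier S" "\<And>i. i \<in> A \<Longrightarrow> \<phi> (y i) = \<phi> (x i)"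
      and o: "\<And>i j. i \<in> A \<Longrightarrow> j \<in> A \<Longrightarrow> i \<noteq> j \<Longrightarrow> sinv S (y i) \<cdot>\<^bsub>S\<^esub> y j = szero S"
    by metis
  let ?p = "x k \<cdot>\<^bsub>S\<^esub> sinv S (x k)" and ?q = "\<lambda>i. y i \<cdot>\<^bsub>S\<^esub> sinv S (y i)"
  have xk: "x k \<in> carrier S"
    using insert.prems by simp
  have "\<phi> ?p \<cdot>\<^bsub>T\<^esub> \<phi> (?q i) = szero T" if i: "i \<in> A" for i
  proof -
    have c: "\<phi> (x k) \<in> carrier T" "\<phi> (x i) \<in> carrier T"
      using insert.prems(1) i by simp_all
    have "\<phi> ?p \<cdot>\<^bsub>T\<^esub> \<phi> (?q i) =
        \<phi> (x k) \<cdot>\<^bsub>T\<^esub> ((sinv T (\<phi> (x k)) \<cdot>\<^bsub>T\<^esub> \<phi> (x i)) \<cdot>\<^bsub>T\<^esub> sinv T (\<phi> (x i)))"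
      using y[OF i] xk c by (simp add: T.mult_assoc)
    also have "sinv T (\<phi> (x k)) \<cdot>\<^bsub>T\<^esub> \<phi> (x i) = szero T"
      using insert.prems(2)[of k i] insert.hyps i by blast
    finally show ?thesis
      using c by simp
  qed
  then obtain z where z: "S.idem z" "\<phi> z = \<phi> ?p" "\<And>i. i \<in> A \<Longrightarrow> z \<cdot>\<^bsub>S\<^esub> ?q i = szero S"
    using ex_disjoint_part_finite[OF insert.hyps(1), of ?p ?q] xk y(1) by auto
  define w where "w = z \<cdot>\<^bsub>S\<^esub> x k"
  have w: "w \<in> carrier S"
    using z(1) xk by (simp add: w_def)
  have "\<phi> w = \<phi> (x k)"
    using z(1,2) xk by (simp add: w_def T.mult_assoc)
  have wy: "sinv S w \<cdot>\<^bsub>S\<^esub> y i = szero S" if i: "i \<in> A" for i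
  proof -
    have "sinv S w \<cdot>\<^bsub>S\<^esub> y i = sinv S (x k) \<cdot>\<^bsub>S\<^esub> ((z \<cdot>\<^bsub>S\<^esub> ?q i) \<cdot>\<^bsub>S\<^esub> y i)"
      using z(1) xk y(1)[OF i] by (simp add: w_def S.sinv_mult S.mult_assoc)
    then show ?thesis
      using z(3)[OF i] y(1)[OF i] xk by simp
  qed
  have yw: "sinv S (y i) \<cdot>\<^bsub>S\<^esub> w = szero S" if i: "i \<in> A" for i
  proof -
    have "sinv S (y i) \<cdot>\<^bsub>S\<^esub> w = sinv S (sinv S w \<cdot>\<^bsub>S\<^esub> y i)"
      using w y(1)[OF i] by (simp add: S.sinv_mult)
    then show ?thesis
      using wy[OF i] by simp
  qed
  show ?case
    using w \<open>\<phi> w = \<phi> (x k)\<close> wy yw y o insert.hyps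
    by (intro exI[of _ "y(k := w)"]) auto
qed

lemma ex_common_idem_below:
  assumes "finite A" "T.idem e" "S.idem d" "\<phi> d = e"
    "\<And>i. i \<in> A \<Longrightarrow> S.idem (r i) \<and> \<phi> (r i) = e"
  shows "\<exists>d. S.idem d \<and> \<phi> d = e \<and> (\<forall>i\<in>A. r i \<cdot>\<^bsub>S\<^esub> d = d)"
  using assms(1,5)
proof (induction A rule: finite_induct)
  case empty
  then show ?case
    using assms(3,4) by auto
next
  case (insert k A)
  then obtain d where d: "S.idem d" "\<phi> d = e" "\<And>i. i \<in> A \<Longrightarrow> r i \<cdot>\<^bsub>S\<^esub> d = d"
    by auto
  have rk: "S.idem (r k)" "\<phi> (r k) = e"
    using insert.prems by simp_all
  have "r i \<cdot>\<^bsub>S\<^esub> (r k \<cdot>\<^bsub>S\<^esub> d) = r k \<cdot>\<^bsub>S\<^esub> d" if "i \<in> insert k A" for i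
    using that rk(1) d insert.prems[OF that] S.idem_left_commute[of "r i" "r k" d] by auto
  then show ?case
    using rk d(1,2) assms(2) by (intro exI[of _ "r k \<cdot>\<^bsub>S\<^esub> d"]) auto
qed

text \<open>Lifting a single column \<open>v i a\<close> is enough, since it determines all the units through
  \<open>v i j = v i a \<cdot> (v j a)\<^sup>-\<close>.\<close>

lemma lift_matrix_units:
  assumes I: "finite I" and surj: "\<phi> ` carrier S = carrier T" and v: "matrix_units T I v"
  shows "\<exists>u. matrix_units S I u \<and> (\<forall>i\<in>I. \<forall>j\<in>I. \<phi> (u i j) = v i j)"
proof (cases "I = {}")
  case True
  then show ?thesis
    by (auto simp: matrix_units_def matrix_units_axioms_def S.bias_axioms)
next
  case False
  then obtain a where a: "a \<in> I"
    by blast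
  interpret V: matrix_units T I v by (rule v)
  have "\<forall>i\<in>I. \<exists>x\<in>carrier S. \<phi> x = v i a"
    using surj a V.unit_closed by (metis image_iff)
  then obtain x where x: "\<And>i. i \<in> I \<Longrightarrow> x i \<in> carrier S" "\<And>i. i \<in> I \<Longrightarrow> \<phi> (x i) = v i a"
    by metis
  have "sinv T (\<phi> (x i)) \<cdot>\<^bsub>T\<^esub> \<phi> (x j) = szero T" if "i \<in> I" "j \<in> I" "i \<noteq> j" for i j
    using that a x by (simp add: V.unit_sinv V.unit_mult)
  then have "\<exists>y. (\<forall>i\<in>I. y i \<in> carrier S \<and> \<phi> (y i) = \<phi> (x i)) \<and>
      (\<forall>i\<in>I. \<forall>j\<in>I. i \<noteq> j \<longrightarrow> sinv S (y i) \<cdot>\<^bsub>S\<^esub> y j = szero S)"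
    using x(1) by (intro ex_orthogonal_ranges I) blast+
  then obtain y where y: "\<And>i. i \<in> I \<Longrightarrow> y i \<in> carrier S" "\<And>i. i \<in> I \<Longrightarrow> \<phi> (y i) = v i a"
      and o: "\<And>i j. i \<in> I \<Longrightarrow> j \<in> I \<Longrightarrow> i \<noteq> j \<Longrightarrow> sinv S (y i) \<cdot>\<^bsub>S\<^esub> y j = szero S"
    using x(2) by metis
  let ?r = "\<lambda>i. sinv S (y i) \<cdot>\<^bsub>S\<^esub> y i"
  have r: "S.idem (?r i)" "\<phi> (?r i) = v a a" if "i \<in> I" for i
    using that a y by (simp_all add: V.unit_sinv V.unit_mult)
  obtain d where d: "S.idem d" "\<phi> d = v a a" and rd: "\<And>i. i \<in> I \<Longrightarrow> ?r i \<cdot>\<^bsub>S\<^esub> d = d"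
    using ex_common_idem_below[OF I _ r[OF a], of ?r] a r by auto
  let ?u = "\<lambda>i j. y i \<cdot>\<^bsub>S\<^esub> (d \<cdot>\<^bsub>S\<^esub> sinv S (y j))"
  have "matrix_units S I ?u"
    by (rule S.matrix_units_of_orthogonal_ranges[OF I y(1) d(1) rd o])
  moreover have "\<forall>i\<in>I. \<forall>j\<in>I. \<phi> (?u i j) = v i j"
    using a y d by (simp add: V.unit_sinv V.unit_mult)
  ultimately show ?thesis
    by (intro exI[of _ ?u] conjI)
qed

end

section \<open>Symmetric inverse monoids are biases\<close>

text \<open>An order isomorphic to a ring of sets is a generalized Boolean algebra. Binary intersections
  come from differences through \<open>A \<inter> B = A - (A - B)\<close>.\<close>

lemma generalized_boolean_algebra_of_sets:
  fixes L :: "('a, 'm) gorder_scheme" and D :: "'a \<Rightarrow> 'b set"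
  assumes eq: "(.=\<^bsub>L\<^esub>) = (=)"
    and le: "\<And>x y. x \<in> carrier L \<Longrightarrow> y \<in> carrier L \<Longrightarrow> x \<sqsubseteq>\<^bsub>L\<^esub> y \<longleftrightarrow> D x \<subseteq> D y"
    and inj: "inj_on D (carrier L)"
    and empty: "{} \<in> D ` carrier L"
    and union: "\<And>x y. x \<in> carrier L \<Longrightarrow> y \<in> carrier L \<Longrightarrow> D x \<union> D y \<in> D ` carrier L"
    and diff: "\<And>x y. x \<in> carrier L \<Longrightarrow> y \<in> carrier L \<Longrightarrow> D x - D y \<in> D ` carrier L"
  shows "generalized_boolean_algebra L"
proof -
  have inter: "D x \<inter> D y \<in> D ` carrier L" if xy: "x \<in> carrier L" "y \<in> carrier L" for x y
  proof -
    obtain z where "z \<in> carrier L" "D z = D x - D y"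
      using diff[OF xy] by auto
    then show ?thesis
      using diff[OF xy(1), of z] by (simp add: Diff_Diff_Int)
  qed
  have po: "partial_order L"
    by unfold_locales (use eq le inj in \<open>auto simp: inj_on_def\<close>)
  have eq_iff: "s = j \<longleftrightarrow> s \<in> carrier L \<and> D s = D j" if "j \<in> carrier L" for s j
    using that inj by (auto simp: inj_on_def)
  have upper: "z \<in> Upper L {x, y} \<longleftrightarrow> z \<in> carrier L \<and> D x \<subseteq> D z \<and> D y \<subseteq> D z"
    and lower: "z \<in> Lower L {x, y} \<longleftrightarrow> z \<in> carrier L \<and> D z \<subseteq> D x \<and> D z \<subseteq> D y"
    if xy: "x \<in> carrier L" "y \<in> carrier L" for x y z
    using xy le[OF xy(1), of z] le[OF xy(2), of z] le[OF _ xy(1), of z] le[OF _ xy(2), of z]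
    by (auto simp: Upper_def Lower_def)
  have lub: "least L s (Upper L {x, y}) \<longleftrightarrow> s \<in> carrier L \<and> D s = D x \<union> D y"
    if xy: "x \<in> carrier L" "y \<in> carrier L" for s x y
  proof -
    obtain j where j: "j \<in> carrier L" "D j = D x \<union> D y"
      using union[OF xy] by auto
    then have "least L j (Upper L {x, y})"
      unfolding least_def using upper[OF xy] le by (intro conjI subsetI ballI) auto
    then have "least L s (Upper L {x, y}) \<longleftrightarrow> s = j"
      using partial_order.least_unique[OF po] by blast
    then show ?thesis
      using eq_iff[OF j(1)] j(2) by simp
  qed
  have glb: "greatest L s (Lower L {x, y}) \<longleftrightarrow> s \<in> carrier L \<and> D s = D x \<inter> D y"
    if xy: "x \<in> carrier L" "y \<in> carrier L" for s x y
  proof -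
    obtain j where j: "j \<in> carrier L" "D j = D x \<inter> D y"
      using inter[OF xy] by auto
    then have "greatest L j (Lower L {x, y})"
      unfolding greatest_def using lower[OF xy] le by (intro conjI subsetI ballI) auto
    then have "greatest L s (Lower L {x, y}) \<longleftrightarrow> s = j"
      using partial_order.greatest_unique[OF po] by blast
    then show ?thesis
      using eq_iff[OF j(1)] j(2) by simp
  qed
  have bot: "least L s (carrier L) \<longleftrightarrow> s \<in> carrier L \<and> D s = {}" for s
  proof -
    obtain b where b: "b \<in> carrier L" "D b = {}"
      using empty by auto
    then have "least L b (carrier L)"
      by (auto simp: least_def le)
    then have "least L s (carrier L) \<longleftrightarrow> s = b"
      using partial_order.least_unique[OF po] by blast
    then show ?thesis
      using eq_iff[OF b(1)] b(2) by simp
  qed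
  have "\<exists>s. s \<in> carrier L \<and> D s = D x \<union> D y" "\<exists>s. s \<in> carrier L \<and> D s = D x \<inter> D y"
    if "x \<in> carrier L" "y \<in> carrier L" for x y
    using union[OF that] inter[OF that] by (metis imageE)+
  then have lattice: "lattice L"
    using po
    by (simp add: lattice_def upper_semilattice_def lower_semilattice_def
        upper_semilattice_axioms_def lower_semilattice_axioms_def lub glb)
  have "\<exists>s. s \<in> carrier L \<and> D s = {}"
    using empty by (metis imageE)
  then have bottom: "weak_partial_order_bottom L"
    using po by (simp add: weak_partial_order_bottom_def weak_partial_order_bottom_axioms_def
        bot partial_order_def)
  have join: "x \<squnion>\<^bsub>L\<^esub> y \<in> carrier L \<and> D (x \<squnion>\<^bsub>L\<^esub> y) = D x \<union> D y"
    if xy: "x \<in> carrier L" "y \<in> carrier L" for x y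
    unfolding join_def sup_def lub[OF xy] by (rule someI_ex) (use union[OF xy] in auto)
  have meet: "x \<sqinter>\<^bsub>L\<^esub> y \<in> carrier L \<and> D (x \<sqinter>\<^bsub>L\<^esub> y) = D x \<inter> D y"
    if xy: "x \<in> carrier L" "y \<in> carrier L" for x y
    unfolding meet_def inf_def glb[OF xy] by (rule someI_ex) (use inter[OF xy] in auto)
  have bottom_eq: "\<bottom>\<^bsub>L\<^esub> \<in> carrier L \<and> D \<bottom>\<^bsub>L\<^esub> = {}"
    unfolding bottom_def bot by (rule someI_ex) (use empty in auto)
  have D_eq: "x = y" if "D x = D y" "x \<in> carrier L" "y \<in> carrier L" for x y
    using that inj by (auto simp: inj_on_def)
  have "x \<sqinter>\<^bsub>L\<^esub> (y \<squnion>\<^bsub>L\<^esub> z) = (x \<sqinter>\<^bsub>L\<^esub> y) \<squnion>\<^bsub>L\<^esub> (x \<sqinter>\<^bsub>L\<^esub> z)"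
    if "x \<in> carrier L" "y \<in> carrier L" "z \<in> carrier L" for x y z
    using that by (intro D_eq) (auto simp: join meet)
  moreover have "\<exists>z\<in>carrier L. x \<sqinter>\<^bsub>L\<^esub> z = \<bottom>\<^bsub>L\<^esub> \<and> x \<squnion>\<^bsub>L\<^esub> z = y"
    if xy: "x \<in> carrier L" "y \<in> carrier L" "x \<sqsubseteq>\<^bsub>L\<^esub> y" for x y
  proof -
    obtain z where z: "z \<in> carrier L" "D z = D y - D x"
      using diff[OF xy(2,1)] by auto
    have "D x \<subseteq> D y"
      using le xy by simp
    then have "x \<sqinter>\<^bsub>L\<^esub> z = \<bottom>\<^bsub>L\<^esub>" "x \<squnion>\<^bsub>L\<^esub> z = y"
      using xy z bottom_eq by (intro D_eq; auto simp: join meet)+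
    then show ?thesis
      using z(1) by blast
  qed
  ultimately show ?thesis
    using lattice bottom
    by (simp add: generalized_boolean_algebra_def generalized_boolean_algebra_axioms_def)
qed

definition map_inverse :: "('i \<rightharpoonup> 'j) \<Rightarrow> ('j \<rightharpoonup> 'i)"
  where "map_inverse f y = (if \<exists>x. f x = Some y then Some (THE x. f x = Some y) else None)"

lemma map_inverse_iff:
  assumes "partial_bij I f"
  shows "map_inverse f y = Some x \<longleftrightarrow> f x = Some y"
proof -
  have "(THE x. f x = Some y) = x" if "f x = Some y" for x
    using that partial_bij_inj[OF assms] by (intro the_equality) auto
  then show ?thesis
    by (auto simp: map_inverse_def)
qed

lemma partial_bij_map_inverse: "partial_bij I f \<Longrightarrow> partial_bij I (map_inverse f)"
  by (rule partial_bijI) (auto simp: map_inverse_iff dest: partial_bijD)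

lemma carrier_symmetric_inverse_monoid [simp]:
  "f \<in> carrier (symmetric_inverse_monoid n) \<longleftrightarrow> partial_bij {1..n} f"
  by (simp add: symmetric_inverse_monoid_def partial_bij_def)

lemma mult_symmetric_inverse_monoid [simp]:
  "f \<cdot>\<^bsub>symmetric_inverse_monoid n\<^esub> g = f \<circ>\<^sub>m g"
  by (simp add: symmetric_inverse_monoid_def)

lemma zero_symmetric_inverse_monoid [simp]: "szero (symmetric_inverse_monoid n) = Map.empty"
  by (simp add: symmetric_inverse_monoid_def)

lemma is_inverse_map_inverse:
  assumes f: "partial_bij {1..n} f"
  shows "is_inverse (symmetric_inverse_monoid n) f (map_inverse f)"
  unfolding is_inverse_def mult_symmetric_inverse_monoid
proof (intro conjI map_eqI)
  show "f x = Some y \<longleftrightarrow> (f \<circ>\<^sub>m map_inverse f \<circ>\<^sub>m f) x = Some y" for x y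
    using partial_bij_inj[OF f] by (auto simp: map_comp_Some_iff map_inverse_iff[OF f])
  show "map_inverse f y = Some x \<longleftrightarrow> (map_inverse f \<circ>\<^sub>m f \<circ>\<^sub>m map_inverse f) y = Some x" for x y
    using partial_bij_inj[OF f] by (auto simp: map_comp_Some_iff map_inverse_iff[OF f])
qed

lemma is_inverse_unique:
  assumes f: "partial_bij {1..n} f" and g: "partial_bij {1..n} g"
    and fg: "is_inverse (symmetric_inverse_monoid n) f g"
  shows "g = map_inverse f"
proof (rule map_eqI)
  fix y x
  have 1: "f = f \<circ>\<^sub>m g \<circ>\<^sub>m f" and 2: "g = g \<circ>\<^sub>m f \<circ>\<^sub>m g"
    using fg by (auto simp: is_inverse_def)
  have "g y = Some x" if x: "f x = Some y"
  proof -
    from x have "(f \<circ>\<^sub>m g \<circ>\<^sub>m f) x = Some y"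
      by (subst 1[symmetric])
    then obtain x' where "g y = Some x'" "f x' = Some y"
      using x by (auto simp: map_comp_Some_iff)
    then show ?thesis
      using partial_bij_inj[OF f x] by auto
  qed
  moreover have "f x = Some y" if x: "g y = Some x"
  proof -
    from x have "(g \<circ>\<^sub>m f \<circ>\<^sub>m g) y = Some x"
      by (subst 2[symmetric])
    then obtain y' where "f x = Some y'" "g y' = Some x"
      using x by (auto simp: map_comp_Some_iff)
    then show ?thesis
      using partial_bij_inj[OF g x] by auto
  qed
  ultimately show "g y = Some x \<longleftrightarrow> map_inverse f y = Some x"
    by (auto simp: map_inverse_iff[OF f])
qed

lemma inverse_semigroup_zero_symmetric_inverse_monoid:
  "inverse_semigroup_zero (symmetric_inverse_monoid n)"
proof
  fix f g h :: "nat \<rightharpoonup> nat"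
  show "f \<cdot>\<^bsub>symmetric_inverse_monoid n\<^esub> g \<cdot>\<^bsub>symmetric_inverse_monoid n\<^esub> h =
      f \<cdot>\<^bsub>symmetric_inverse_monoid n\<^esub> (g \<cdot>\<^bsub>symmetric_inverse_monoid n\<^esub> h)"
    unfolding mult_symmetric_inverse_monoid by (rule map_eqI) (auto simp: map_comp_Some_iff)
  show "\<exists>!g. g \<in> carrier (symmetric_inverse_monoid n) \<and> is_inverse (symmetric_inverse_monoid n) f g"
    if "f \<in> carrier (symmetric_inverse_monoid n)"
    using that is_inverse_map_inverse is_inverse_unique partial_bij_map_inverse
    by (intro ex1I[of _ "map_inverse f"]) auto
qed (simp_all add: partial_bij_comp, simp_all add: partial_bij_def map_comp_def)

context
  fixes n :: nat
begin

interpretation M: inverse_semigroup_zero "symmetric_inverse_monoid n"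
  by (rule inverse_semigroup_zero_symmetric_inverse_monoid)

lemma sinv_symmetric_inverse_monoid:
  assumes "partial_bij {1..n} f"
  shows "sinv (symmetric_inverse_monoid n) f = map_inverse f"
  using M.sinv_inverse[of f] is_inverse_unique assms by auto

lemma nle_symmetric_inverse_monoid:
  assumes f: "partial_bij {1..n} f" and g: "partial_bij {1..n} g"
  shows "M.nle f g \<longleftrightarrow> f \<subseteq>\<^sub>m g"
proof -
  have *: "(g \<circ>\<^sub>m map_inverse f \<circ>\<^sub>m f) x = (if x \<in> dom f then g x else None)" for x
  proof (cases "f x")
    case (Some y)
    then have "map_inverse f y = Some x"
      by (simp add: map_inverse_iff[OF f])
    then show ?thesis
      using Some by (auto simp: map_comp_def)
  qed (simp add: domIff)
  have "M.nle f g \<longleftrightarrow> (\<forall>x. f x = (if x \<in> dom f then g x else None))"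
    unfolding M.nle_def by (simp add: sinv_symmetric_inverse_monoid[OF f] fun_eq_iff *)
  then show ?thesis
    by (auto simp: map_le_def domIff)
qed

text \<open>If \<open>f \<circ> f = f\<close> and \<open>f x = y\<close>, then also \<open>f y = y\<close>, and injectivity gives \<open>x = y\<close>.\<close>

lemma idem_symmetric_inverse_monoid:
  "M.idem f \<longleftrightarrow> (\<exists>A\<subseteq>{1..n}. f = Some |` A)"
proof
  assume f: "M.idem f"
  then have bij: "partial_bij {1..n} f" and ff: "f \<circ>\<^sub>m f = f"
    using M.idem_closed[OF f] M.idem_mult_self[OF f] by simp_all
  have "f x = Some x" if x: "f x = Some y" for x y
  proof -
    have "(f \<circ>\<^sub>m f) x = Some y"
      using ff x by simp
    then have "f y = Some y"
      using x by (simp add: map_comp_Some_iff)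
    then show ?thesis
      using partial_bij_inj[OF bij x] x by simp
  qed
  then have "f = Some |` dom f"
    by (intro map_eqI) (auto simp: restrict_map_def split: if_splits)
  then show "\<exists>A\<subseteq>{1..n}. f = Some |` A"
    using bij unfolding partial_bij_def by blast
next
  assume "\<exists>A\<subseteq>{1..n}. f = Some |` A"
  then obtain A where A: "A \<subseteq> {1..n}" "f = Some |` A"
    by blast
  then have "partial_bij {1..n} f"
    by (intro partial_bijI) (auto simp: restrict_map_def split: if_splits)
  moreover have "f \<circ>\<^sub>m f = f"
    by (rule map_eqI) (auto simp: A map_comp_Some_iff restrict_map_def split: if_splits)
  ultimately show "M.idem f"
    by (intro M.idemI) simp_all
qed

lemma generalized_boolean_algebra_symmetric_inverse_monoid:
  "generalized_boolean_algebra ((natural_order (symmetric_inverse_monoid n))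
    \<lparr>carrier := idempotents (symmetric_inverse_monoid n)\<rparr>)" (is "generalized_boolean_algebra ?L")
proof (rule generalized_boolean_algebra_of_sets[where D = dom])
  have dom: "dom (Some |` A) = A" for A :: "nat set"
    by (auto simp: restrict_map_def split: if_splits)
  have E: "carrier ?L = (|`) Some ` Pow {1..n}"
    using idem_symmetric_inverse_monoid by auto
  then have carrier: "dom ` carrier ?L = Pow {1..n}"
    by (simp add: image_image dom)
  have sub: "dom x \<subseteq> {1..n}" if "x \<in> carrier ?L" for x
    using imageI[OF that, of dom] unfolding carrier by simp
  show "(.=\<^bsub>?L\<^esub>) = (=)"
    by (simp add: natural_order_def)
  show "inj_on dom (carrier ?L)"
    unfolding E by (rule inj_onI) (auto simp: dom)
  show "x \<sqsubseteq>\<^bsub>?L\<^esub> y \<longleftrightarrow> dom x \<subseteq> dom y" if "x \<in> carrier ?L" "y \<in> carrier ?L" for x y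
  proof -
    have xy: "M.idem x" "M.idem y"
      using that by simp_all
    then have "x \<sqsubseteq>\<^bsub>?L\<^esub> y \<longleftrightarrow> x \<subseteq>\<^sub>m y"
      using nle_symmetric_inverse_monoid[of x y] M.idem_closed[OF xy(1)] M.idem_closed[OF xy(2)]
      by (simp add: natural_order_def M.nle_def)
    also obtain A B where "x = Some |` A" "y = Some |` B"
      using xy idem_symmetric_inverse_monoid by blast
    then have "x \<subseteq>\<^sub>m y \<longleftrightarrow> dom x \<subseteq> dom y"
      by (auto simp: map_le_def restrict_map_def split: if_splits)
    finally show ?thesis .
  qed
  show "{} \<in> dom ` carrier ?L"
    unfolding carrier by simp
  show "dom x \<union> dom y \<in> dom ` carrier ?L" "dom x - dom y \<in> dom ` carrier ?L"
    if "x \<in> carrier ?L" "y \<in> carrier ?L" for x y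
    unfolding carrier using sub[OF that(1)] sub[OF that(2)] by auto
qed

lemma orthogonal_symmetric_inverse_monoid:
  assumes f: "partial_bij {1..n} f" and g: "partial_bij {1..n} g"
    and o: "orthogonal (symmetric_inverse_monoid n) f g"
  shows "dom f \<inter> dom g = {}" "ran f \<inter> ran g = {}"
proof -
  have 1: "map_inverse f \<circ>\<^sub>m g = Map.empty" and 2: "f \<circ>\<^sub>m map_inverse g = Map.empty"
    using o f g by (simp_all add: orthogonal_def sinv_symmetric_inverse_monoid)
  have False if "f x = Some y" "g x = Some z" for x y z
  proof -
    have "(f \<circ>\<^sub>m map_inverse g) z = Some y"
      using that by (auto simp: map_comp_Some_iff map_inverse_iff[OF g])
    then show False
      using 2 by simp
  qed
  then show "dom f \<inter> dom g = {}"
    by (auto simp: dom_def)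
  have False if "f x = Some y" "g z = Some y" for x y z
  proof -
    have "(map_inverse f \<circ>\<^sub>m g) z = Some x"
      using that by (auto simp: map_comp_Some_iff map_inverse_iff[OF f])
    then show False
      using 1 by simp
  qed
  then show "ran f \<inter> ran g = {}"
    by (auto simp: ran_def)
qed

lemma is_join_symmetric_inverse_monoid:
  assumes f: "partial_bij {1..n} f" and g: "partial_bij {1..n} g"
    and o: "orthogonal (symmetric_inverse_monoid n) f g"
  shows "M.is_join f g (f ++ g)"
proof -
  have d: "dom f \<inter> dom g = {}" and r: "ran f \<inter> ran g = {}"
    using orthogonal_symmetric_inverse_monoid assms by blast+
  have fg: "partial_bij {1..n} (f ++ g)"
  proof (rule partial_bijI)
    show "x \<in> {1..n} \<and> y \<in> {1..n}" if "(f ++ g) x = Some y" for x y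
      using that partial_bijD[OF f] partial_bijD[OF g] by (auto simp: map_add_Some_iff)
    show "x = y" if "(f ++ g) x = Some z" "(f ++ g) y = Some z" for x y z
      using that partial_bij_inj[OF f] partial_bij_inj[OF g] r
      by (auto simp: map_add_Some_iff ran_def)
  qed
  have "f \<subseteq>\<^sub>m f ++ g" "g \<subseteq>\<^sub>m f ++ g"
    using map_le_map_add[of f g] map_le_map_add[of g f] map_add_comm[OF d] by simp_all
  then show ?thesis
    using f g fg by (auto simp: M.is_join_def nle_symmetric_inverse_monoid intro: map_add_le_mapI)
qed

end

lemma bias_symmetric_inverse_monoid: "bias (symmetric_inverse_monoid n)"
proof -
  interpret M: inverse_semigroup_zero "symmetric_inverse_monoid n"
    by (rule inverse_semigroup_zero_symmetric_inverse_monoid)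
  show ?thesis
  proof (rule bias.intro[OF M.inverse_semigroup_zero_axioms bias_axioms.intro])
    fix f g :: "nat \<rightharpoonup> nat"
    assume f: "f \<in> carrier (symmetric_inverse_monoid n)"
      and g: "g \<in> carrier (symmetric_inverse_monoid n)"
      and o: "orthogonal (symmetric_inverse_monoid n) f g"
    have "M.is_join f g (f ++ g)"
      using f g o unfolding carrier_symmetric_inverse_monoid
      by (rule is_join_symmetric_inverse_monoid)
    then show "\<exists>s. least (natural_order (symmetric_inverse_monoid n)) s
        (Upper (natural_order (symmetric_inverse_monoid n)) {f, g})"
      using M.least_natural_order_iff[OF f g] by blast
  qed (rule generalized_boolean_algebra_symmetric_inverse_monoid)
qed

section \<open>Projectivity\<close>

lemma map_singleton_comp:
  "[j \<mapsto> i] \<circ>\<^sub>m [l \<mapsto> k] = (if j = k then [l \<mapsto> i] else Map.empty)"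
  by (auto simp: map_comp_def)

lemma matrix_units_symmetric_inverse_monoid:
  "matrix_units (symmetric_inverse_monoid n) {1..n} (\<lambda>i j. [j \<mapsto> i])"
proof -
  interpret bias "symmetric_inverse_monoid n"
    by (rule bias_symmetric_inverse_monoid)
  show ?thesis
    by unfold_locales (auto simp: map_singleton_comp partial_bij_def)
qed

text \<open>Orthogonality is preserved because multiplicativity forces \<open>\<psi>\<close> to commute with inversion. Then
  the join of \<open>\<psi> f\<close> and \<open>\<psi> g\<close> exists and has the columns of \<open>f ++ g\<close>, which is the join of \<open>f\<close> and
  \<open>g\<close>.\<close>

lemma matrix_elem_bias_hom:
  assumes u: "matrix_units S {1..n} u"
  shows "matrix_units.matrix_elem S {1..n} u \<in> bias_hom (symmetric_inverse_monoid n) S"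
proof -
  interpret U: matrix_units S "{1..n}" u by (rule u)
  interpret M: bias "symmetric_inverse_monoid n" by (rule bias_symmetric_inverse_monoid)
  let ?\<psi> = "U.matrix_elem"
  note rep = U.represents_matrix_elem
  have closed: "?\<psi> f \<in> carrier S" if "partial_bij {1..n} f" for f
    using rep[OF that] U.represents_closed by blast
  have mult: "?\<psi> (f \<circ>\<^sub>m g) = ?\<psi> f \<cdot>\<^bsub>S\<^esub> ?\<psi> g" if "partial_bij {1..n} f" "partial_bij {1..n} g" for f g
    using that rep by (intro U.matrix_elem_eq U.represents_mult) auto
  have zero: "?\<psi> Map.empty = szero S"
    by (rule U.matrix_elem_eq[OF U.represents_zero])
  have sinv: "?\<psi> (sinv (symmetric_inverse_monoid n) f) = sinv S (?\<psi> f)"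
    if "partial_bij {1..n} f" for f
    using that closed mult
    by (intro semigroup_hom_sinv[OF M.inverse_semigroup_zero_axioms U.inverse_semigroup_zero_axioms,
          of ?\<psi>]) auto
  have "?\<psi> (f \<squnion>\<^bsub>natural_order (symmetric_inverse_monoid n)\<^esub> g) = ?\<psi> f \<squnion>\<^bsub>natural_order S\<^esub> ?\<psi> g"
    if f: "partial_bij {1..n} f" and g: "partial_bij {1..n} g"
      and o: "orthogonal (symmetric_inverse_monoid n) f g" for f g
  proof -
    have inv: "partial_bij {1..n} (sinv (symmetric_inverse_monoid n) f)"
        "partial_bij {1..n} (sinv (symmetric_inverse_monoid n) g)"
      using M.sinv_closed[of f] M.sinv_closed[of g] f g by simp_all
    have o': "orthogonal S (?\<psi> f) (?\<psi> g)"
      using o mult[OF inv(1) g] mult[OF f inv(2)] f g zero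
      by (simp add: orthogonal_def del: One_nat_def flip: sinv[OF f] sinv[OF g])
    obtain r where r: "U.is_join (?\<psi> f) (?\<psi> g) r"
      using U.ex_join[OF _ _ o'] closed f g by blast
    have "U.represents (f ++ g) r"
      using U.represents_join[OF rep[OF f] rep[OF g] _ o' r]
        orthogonal_symmetric_inverse_monoid(1)[OF f g o] by blast
    then have "?\<psi> (f ++ g) = ?\<psi> f \<squnion>\<^bsub>natural_order S\<^esub> ?\<psi> g"
      using U.matrix_elem_eq U.join_eqI[OF _ _ r] closed f g by simp
    moreover have "f \<squnion>\<^bsub>natural_order (symmetric_inverse_monoid n)\<^esub> g = f ++ g"
      using M.join_eqI[OF _ _ is_join_symmetric_inverse_monoid[OF f g o]] f g by simp
    ultimately show ?thesis
      by simp
  qed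
  then show ?thesis
    unfolding bias_hom_def using closed mult zero by auto
qed

theorem lemma8p1:
  fixes n :: nat
  assumes "n \<ge> 1"
  shows "projective_bias TYPE('s) (symmetric_inverse_monoid n)"
  unfolding projective_bias_def
proof (intro conjI allI impI bias_symmetric_inverse_monoid)
  fix S :: "'s semigroup_zero" and \<phi>
  let ?M = "symmetric_inverse_monoid n"
  assume "bias S \<and> \<phi> \<in> bias_hom S ?M \<and> \<phi> ` carrier S = carrier ?M"
  then have S: "bias S" and hom: "\<phi> \<in> bias_hom S ?M" and surj: "\<phi> ` carrier S = carrier ?M"
    by auto
  interpret bias_homomorphism S ?M \<phi>
    using S hom bias_symmetric_inverse_monoid[of n]
    by (simp add: bias_homomorphism_def bias_homomorphism_axioms_def)
  obtain u where u: "matrix_units S {1..n} u"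
      and \<phi>u: "\<And>i j. i \<in> {1..n} \<Longrightarrow> j \<in> {1..n} \<Longrightarrow> \<phi> (u i j) = [j \<mapsto> i]"
    using lift_matrix_units[OF _ surj matrix_units_symmetric_inverse_monoid] by auto
  interpret U: matrix_units S "{1..n}" u by (rule u)
  have "\<phi> (U.matrix_elem f) = f" if f: "partial_bij {1..n} f" for f
  proof
    fix j
    let ?s = "U.matrix_elem f"
    have s: "?s \<in> carrier S" and
        col: "\<And>j. j \<in> {1..n} \<Longrightarrow> ?s \<cdot>\<^bsub>S\<^esub> u j j = U.column f j"
      using U.represents_matrix_elem[OF f] unfolding U.represents_def by blast+
    show "\<phi> ?s j = f j"
    proof (cases "j \<in> {1..n}")
      case True
      \<comment> \<open>Composing with \<open>[j \<mapsto> j] = \<phi> (u j j)\<close> isolates the value at \<open>j\<close>.\<close>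
      have "\<phi> ?s j = (\<phi> ?s \<circ>\<^sub>m [j \<mapsto> j]) j"
        by (simp add: map_comp_def)
      also have "\<phi> ?s \<circ>\<^sub>m [j \<mapsto> j] = \<phi> (U.column f j)"
        using hom_mult[OF s, of "u j j"] True by (simp add: \<phi>u col del: One_nat_def)
      also have "\<phi> (U.column f j) j = f j"
        using True partial_bijD[OF f] hom_zero by (auto simp: U.column_def \<phi>u split: option.split)
      finally show ?thesis .
    next
      case False
      have "partial_bij {1..n} (\<phi> ?s)"
        using hom_closed[OF s] by simp
      then show ?thesis
        using False f by (metis not_None_eq partial_bijD(1))
    qed
  qed
  then show "\<exists>\<psi>\<in>bias_hom ?M S. \<forall>x\<in>carrier ?M. \<phi> (\<psi> x) = x"
    by (intro bexI[OF _ matrix_elem_bias_hom[OF u]] ballI) (simp del: One_nat_def)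
qed

end
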